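(* Let $X_0\xrightarrow{\varphi}X_1\xleftarrow{\pi}Y\times X_0$ be a fully injective similarity scheme. Then $\mathcal R_\infty=\widehat{\mathcal R}_\infty$ as equivalence relations on $Y^{\mathbb N}$. This means that $X_\infty=Y^{\mathbb N}/\mathcal R_\infty$, with the embedding $\varphi_{\infty,0}:X_0\to X_\infty$, is a fixed point of the similarity scheme: $\Phi(X_\infty,\varphi_{\infty,0})\cong(X_\infty,\varphi_{\infty,0})$.
   Context: Similarity scheme. A similarity scheme $X_0\xrightarrow{\varphi}X_1\xleftarrow{\pi}Y\times X_0$ consists of compact Hausdorff spaces $X_0,X_1,Y$, a continuous injective map $\varphi:X_0\to X_1$ and a continuous surjective map $\pi:Y\times X_0\to X_1$. The functor $\Phi$. For a pair $(Z,\varphi_Z)$ with $Z$ compact Hausdorff and $\varphi_Z:X_0\to Z$ continuous injective, let $\widehat Z=(Y\times Z)/\sim$ with the quotient topology and quotient map $\pi_Z$, where $(y,z)\sim(y',z')$ iff either $(y,z)=(y',z')$ or there are $x_0,x_0'\in X_0$ with $z=\varphi_Z(x_0)$, $z'=\varphi_Z(x_0')$, $\pi(y,x_0)=\pi(y',x_0')$. Let $\varphi_{\widehat Z,X_1}:X_1\to\widehat Z$ be the (well-defined, continuous, injective) map with $\varphi_{\widehat Z,X_1}(\pi(y,x_0))=\pi_Z(y,\varphi_Z(x_0))$, let $\varphi_{\widehat Z}=\varphi_{\widehat Z,X_1}\circ\varphi$, and $\Phi(Z,\varphi_Z)=(\widehat Z,\varphi_{\widehat Z})$. An isomorphism $(Z,\varphi_Z)\cong(W,\varphi_W)$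 is a homeomorphism $\vartheta:Z\to W$ with $\varphi_W=\vartheta\circ\varphi_Z$. Tower. Put $\varphi_{1,0}=\varphi$, $\pi_{1,0}=\pi$. For $n\ge1$ let $(X_{n+1},\varphi_{n+1,0})=\Phi(X_n,\varphi_{n,0})$, with quotient map $\pi_{1,n}:Y\times X_n\to X_{n+1}$, and let $\varphi_{n+1,n}:X_n\to X_{n+1}$ be the (well-defined, continuous, injective) map with $\varphi_{n+1,n}(\pi_{1,n-1}(y,x))=\pi_{1,n}(y,\varphi_{n,n-1}(x))$. For $n\ge m$, $\varphi_{n,m}:X_m\to X_n$ is the composite $\varphi_{n,n-1}\circ\cdots\circ\varphi_{m+1,m}$ ($\varphi_{n,n}=\mathrm{id}$). Define $\pi_{p,q}:Y^p\times X_q\to X_{p+q}$ by $\pi_{0,q}=\mathrm{id}$ and $\pi_{p,q}=\pi_{p-1,q+1}\circ(\mathrm{id}_{Y^{p-1}}\times\pi_{1,q})$ for $p\ge1$. Limit space. For $(y_1,\dots,y_p)\in Y^p$ the cell is $C(y_1,\dots,y_p)=\{\pi_{p,0}(y_1,\dots,y_p,x):x\in X_0\}\subset X_p$ (for $p=0$ it is $X_0$). $Y^{\mathbb N}$ is the space of sequences $(y_1,y_2,\dots)$ in $Y$ with the product topology. For $x_n\in X_n$, $\Gamma_n(x_n)=\{(y_1,y_2,\dots)\in Y^{\mathbb N}:\varphi_{p,n}(x_n)\in C(y_1,\dots,y_p)\ \forall p\ge n\}$ (a nonempty closed set). The relation $\mathcal R$ on $Y^{\mathbb N}$: $u\,\mathcal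 R\,v$ iff $u=v$ or there are $n\ge0$ and $x_n\in X_n$ with $u,v\in\Gamma_n(x_n)$. $\mathcal R_\infty$ is the smallest equivalence relation containing $\mathcal R$; $X_\infty=Y^{\mathbb N}/\mathcal R_\infty$ has the quotient topology and $\pi^{\mathbb N}:Y^{\mathbb N}\to X_\infty$ is the quotient map. $\varphi_{\infty,n}:X_n\to X_\infty$ sends $x_n$ to the unique element of $\pi^{\mathbb N}(\Gamma_n(x_n))$. The scheme is fully injective if all $\varphi_{\infty,n}$, $n\ge0$, are injective. The relation $\widehat{\mathcal R}_\infty$ on $Y^{\mathbb N}$: $(y_1,y_2,\dots)\,\widehat{\mathcal R}_\infty\,(y'_1,y'_2,\dots)$ iff either (i) $y_1=y_1'$ and the tails $(y_2,y_3,\dots)$, $(y_2',y_3',\dots)$ are equal or both lie in $\Gamma_n(x_n)$ for some $n\ge0$, $x_n\in X_n$; or (ii) there are $x_0,x_0'\in X_0$ with $\pi_{1,0}(y_1,x_0)=\pi_{1,0}(y_1',x_0')$, $(y_2,y_3,\dots)\in\Gamma_0(x_0)$ and $(y_2',y_3',\dots)\in\Gamma_0(x_0')$. Under the homeomorphism $Y\times Y^{\mathbb N}\cong Y^{\mathbb N}$, $(y,u)\mapsto(y,u_1,u_2,\dots)$, it is the relation whose quotient is the space $\widehat X_\infty$ of $\Phi(X_\infty,\varphi_{\infty,0})$. *)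

theory Defs
  imports "HOL-Analysis.Analysis"
begin

subsection \<open>Quotient spaces\<close>

definition quot_top :: "'a topology \<Rightarrow> ('a \<Rightarrow> 'b) \<Rightarrow> 'b topology" where
  "quot_top X f =
     topology (\<lambda>U. U \<subseteq> f ` topspace X \<and> openin X {x \<in> topspace X. f x \<in> U})"

lemma openin_quot_top:
  "openin (quot_top X f) U \<longleftrightarrow> U \<subseteq> f ` topspace X \<and> openin X {x \<in> topspace X. f x \<in> U}"
proof -
  let ?P = "\<lambda>U. U \<subseteq> f ` topspace X \<and> openin X {x \<in> topspace X. f x \<in> U}"
  have "?P (A \<inter> B)" if "?P A" "?P B" for A B
  proof -
    have "{x \<in> topspace X. f x \<in> A \<inter> B} = {x \<in> topspace X. f x \<in> A} \<inter> {x \<in> topspace X. f x \<in> B}"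
      by auto
    then show ?thesis using that by auto
  qed
  moreover have "?P (\<Union>K)" if "\<forall>A\<in>K. ?P A" for K
  proof -
    have "{x \<in> topspace X. f x \<in> \<Union>K} = (\<Union>A\<in>K. {x \<in> topspace X. f x \<in> A})"
      by auto
    moreover have "openin X (\<Union>A\<in>K. {x \<in> topspace X. f x \<in> A})"
      using that by (intro openin_Union) auto
    ultimately have "openin X {x \<in> topspace X. f x \<in> \<Union>K}" by simp
    then show ?thesis using that by auto
  qed
  ultimately have "istopology ?P" unfolding istopology_def by meson
  then show ?thesis unfolding quot_top_def by (simp add: topology_inverse')
qed

lemma topspace_quot_top: "topspace (quot_top X f) = f ` topspace X"
proof
  show "topspace (quot_top X f) \<subseteq> f ` topspace X"
    using openin_quot_top[of X f "topspace (quot_top X f)"] by simp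
  have "{x \<in> topspace X. f x \<in> f ` topspace X} = topspace X" by auto
  then have "openin (quot_top X f) (f ` topspace X)" by (simp add: openin_quot_top)
  then show "f ` topspace X \<subseteq> topspace (quot_top X f)" by (rule openin_subset)
qed

lemma quotient_map_quot_top: "quotient_map X (quot_top X f) f"
  unfolding quotient_map_def by (simp add: topspace_quot_top openin_quot_top)

lemma homeomorphic_map_quot_top:
  "inj_on f (topspace X) \<Longrightarrow> homeomorphic_map X (quot_top X f) f"
  by (simp add: homeomorphic_map_def quotient_map_quot_top)


subsection \<open>Similarity schemes and the functor \<open>\<Phi>\<close>\<close>

record ('a, 'b, 'y) scheme =
  X0 :: "'a topology"
  X1 :: "'b topology"
  YY :: "'y topology"
  phi :: "'a \<Rightarrow> 'b"
  proj :: "'y \<times> 'a \<Rightarrow> 'b"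

definition similarity_scheme :: "('a, 'b, 'y) scheme \<Rightarrow> bool" where
  "similarity_scheme S \<longleftrightarrow>
     compact_space (X0 S) \<and> Hausdorff_space (X0 S) \<and>
     compact_space (X1 S) \<and> Hausdorff_space (X1 S) \<and>
     compact_space (YY S) \<and> Hausdorff_space (YY S) \<and>
     continuous_map (X0 S) (X1 S) (phi S) \<and> inj_on (phi S) (topspace (X0 S)) \<and>
     continuous_map (prod_topology (YY S) (X0 S)) (X1 S) (proj S) \<and>
     proj S ` topspace (prod_topology (YY S) (X0 S)) = topspace (X1 S)"

text \<open>The objects of the category on which \<open>\<Phi>\<close> acts.\<close>

definition scheme_pair :: "('a, 'b, 'y) scheme \<Rightarrow> 'z topology \<times> ('a \<Rightarrow> 'z) \<Rightarrow> bool" where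
  "scheme_pair S P \<longleftrightarrow>
     compact_space (fst P) \<and> Hausdorff_space (fst P) \<and>
     continuous_map (X0 S) (fst P) (snd P) \<and> inj_on (snd P) (topspace (X0 S))"

definition pair_iso ::
  "('a, 'b, 'y) scheme \<Rightarrow> 'z topology \<times> ('a \<Rightarrow> 'z) \<Rightarrow> 'w topology \<times> ('a \<Rightarrow> 'w) \<Rightarrow> bool" where
  "pair_iso S P Q \<longleftrightarrow>
     (\<exists>\<theta>. homeomorphic_map (fst P) (fst Q) \<theta> \<and> (\<forall>x \<in> topspace (X0 S). snd Q x = \<theta> (snd P x)))"

definition hat_rel ::
  "('a, 'b, 'y) scheme \<Rightarrow> 'z topology \<times> ('a \<Rightarrow> 'z) \<Rightarrow> (('y \<times> 'z) \<times> ('y \<times> 'z)) set" where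
  "hat_rel S P =
     {((y, z), (y', z')) | y z y' z'.
        (y, z) \<in> topspace (prod_topology (YY S) (fst P)) \<and>
        (y', z') \<in> topspace (prod_topology (YY S) (fst P)) \<and>
        ((y, z) = (y', z') \<or>
         (\<exists>x \<in> topspace (X0 S). \<exists>x' \<in> topspace (X0 S).
            z = snd P x \<and> z' = snd P x' \<and> proj S (y, x) = proj S (y', x')))}"

definition hat_proj ::
  "('a, 'b, 'y) scheme \<Rightarrow> 'z topology \<times> ('a \<Rightarrow> 'z) \<Rightarrow> 'y \<times> 'z \<Rightarrow> ('y \<times> 'z) set" where
  "hat_proj S P w = hat_rel S P `` {w}"

definition hat_space ::
  "('a, 'b, 'y) scheme \<Rightarrow> 'z topology \<times> ('a \<Rightarrow> 'z) \<Rightarrow> ('y \<times> 'z) set topology" where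
  "hat_space S P = quot_top (prod_topology (YY S) (fst P)) (hat_proj S P)"

definition hat_emb1 ::
  "('a, 'b, 'y) scheme \<Rightarrow> 'z topology \<times> ('a \<Rightarrow> 'z) \<Rightarrow> 'b \<Rightarrow> ('y \<times> 'z) set" where
  "hat_emb1 S P x1 =
     (THE w. \<exists>y \<in> topspace (YY S). \<exists>x \<in> topspace (X0 S).
        x1 = proj S (y, x) \<and> w = hat_proj S P (y, snd P x))"

definition Phi ::
  "('a, 'b, 'y) scheme \<Rightarrow> 'z topology \<times> ('a \<Rightarrow> 'z) \<Rightarrow>
     ('y \<times> 'z) set topology \<times> ('a \<Rightarrow> ('y \<times> 'z) set)" where
  "Phi S P = (hat_space S P, hat_emb1 S P \<circ> phi S)"

definition Phi_fixed_point :: "('a, 'b, 'y) scheme \<Rightarrow> 'z topology \<times> ('a \<Rightarrow> 'z) \<Rightarrow> bool" where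
  "Phi_fixed_point S P \<longleftrightarrow> scheme_pair S P \<and> pair_iso S (Phi S P) P"

lemma equiv_hat_rel:
  assumes "inj_on (snd P) (topspace (X0 S))"
  shows "equiv (topspace (prod_topology (YY S) (fst P))) (hat_rel S P)"
proof (rule equivI)
  show "hat_rel S P \<subseteq> topspace (prod_topology (YY S) (fst P)) \<times> topspace (prod_topology (YY S) (fst P))"
    unfolding hat_rel_def by blast
  show "refl_on (topspace (prod_topology (YY S) (fst P))) (hat_rel S P)"
    unfolding hat_rel_def refl_on_def by fast
  show "sym (hat_rel S P)"
    by (rule symI) (unfold hat_rel_def, clarsimp, metis)
  show "trans (hat_rel S P)"
  proof (rule transI)
    fix p q r
    assume pq: "(p, q) \<in> hat_rel S P" and qr: "(q, r) \<in> hat_rel S P"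
    obtain y z y' z' y'' z'' where e: "p = (y, z)" "q = (y', z')" "r = (y'', z'')"
      by (metis surj_pair)
    from pq qr inj_onD[OF assms] show "(p, r) \<in> hat_rel S P"
      unfolding e hat_rel_def mem_Collect_eq Pair_inject
      by (elim exE conjE) (simp, metis)
  qed
qed


subsection \<open>The tower\<close>

text \<open>
  The iterates of \<open>\<Phi>\<close> have ever growing types.  To collect all \<open>X\<^sub>n\<close> in one type, \<open>X\<^sub>0\<close> and \<open>X\<^sub>1\<close>
  are copied along the constructors \<open>Pt0\<close> and \<open>Pt1\<close>, and \<open>\<Phi>(X\<^sub>n)\<close> is copied along the map \<open>code\<close>,
  which names a class of \<open>Y \<times> X\<^sub>n\<close> by a chosen representative.  By \<open>inj_on_code\<close> and
  \<open>homeomorphic_map_quot_top\<close> the copies are homeomorphic to the originals.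
\<close>

datatype ('a, 'b, 'y) pt = Pt0 'a | Pt1 'b | PtQ 'y "('a, 'b, 'y) pt"

definition code :: "('y \<times> ('a, 'b, 'y) pt) set \<Rightarrow> ('a, 'b, 'y) pt" where
  "code C = (case (SOME p. p \<in> C) of (y, z) \<Rightarrow> PtQ y z)"

lemma inj_on_code:
  assumes "equiv A r" shows "inj_on code (A // r)"
proof (rule inj_onI)
  fix C D assume CD: "C \<in> A // r" "D \<in> A // r" "code C = code D"
  have "(SOME p. p \<in> C) = (SOME p. p \<in> D)"
    using CD(3) by (auto simp: code_def split: prod.splits)
  moreover have "(SOME p. p \<in> C) \<in> C" "(SOME p. p \<in> D) \<in> D"
    using CD(1,2) in_quotient_imp_non_empty[OF assms] by (simp_all add: some_in_eq)
  ultimately show "C = D"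
    using quotient_disj[OF assms CD(1,2)] by auto
qed

lemma topspace_hat_space:
  "topspace (hat_space S P) = topspace (prod_topology (YY S) (fst P)) // hat_rel S P"
  by (auto simp: hat_space_def topspace_quot_top hat_proj_def quotient_def)

text \<open>\<open>tower S n\<close> is the pair \<open>(X\<^sub>n, \<phi>\<^sub>n\<^sub>,\<^sub>0)\<close>.\<close>

fun tower :: "('a, 'b, 'y) scheme \<Rightarrow> nat \<Rightarrow>
    ('a, 'b, 'y) pt topology \<times> ('a \<Rightarrow> ('a, 'b, 'y) pt)" where
  "tower S 0 = (quot_top (X0 S) Pt0, Pt0)"
| "tower S (Suc 0) = (quot_top (X1 S) Pt1, Pt1 \<circ> phi S)"
| "tower S (Suc (Suc n)) =
     (quot_top (fst (Phi S (tower S (Suc n)))) code, code \<circ> snd (Phi S (tower S (Suc n))))"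

definition XX :: "('a, 'b, 'y) scheme \<Rightarrow> nat \<Rightarrow> ('a, 'b, 'y) pt topology" where
  "XX S n = fst (tower S n)"

text \<open>\<open>pi1 S n\<close> is \<open>\<pi>\<^sub>1\<^sub>,\<^sub>n : Y \<times> X\<^sub>n \<rightarrow> X\<^sub>n\<^sub>+\<^sub>1\<close>.\<close>

fun pi1 :: "('a, 'b, 'y) scheme \<Rightarrow> nat \<Rightarrow> 'y \<times> ('a, 'b, 'y) pt \<Rightarrow> ('a, 'b, 'y) pt" where
  "pi1 S 0 (y, x) = (case x of Pt0 a \<Rightarrow> Pt1 (proj S (y, a)) | _ \<Rightarrow> undefined)"
| "pi1 S (Suc n) (y, x) = code (hat_proj S (tower S (Suc n)) (y, x))"

text \<open>\<open>phi_step S n\<close> is \<open>\<phi>\<^sub>n\<^sub>+\<^sub>1\<^sub>,\<^sub>n : X\<^sub>n \<rightarrow> X\<^sub>n\<^sub>+\<^sub>1\<close>.\<close>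

fun phi_step :: "('a, 'b, 'y) scheme \<Rightarrow> nat \<Rightarrow> ('a, 'b, 'y) pt \<Rightarrow> ('a, 'b, 'y) pt" where
  "phi_step S 0 x = (case x of Pt0 a \<Rightarrow> Pt1 (phi S a) | _ \<Rightarrow> undefined)"
| "phi_step S (Suc n) w =
     (THE v. \<exists>y \<in> topspace (YY S). \<exists>x \<in> topspace (XX S n).
        w = pi1 S n (y, x) \<and> v = pi1 S (Suc n) (y, phi_step S n x))"

text \<open>\<open>phi_from S m k\<close> is \<open>\<phi>\<^sub>m\<^sub>+\<^sub>k\<^sub>,\<^sub>m\<close>, so that \<open>phi_nm S n m\<close> is \<open>\<phi>\<^sub>n\<^sub>,\<^sub>m\<close> for \<open>n \<ge> m\<close>.\<close>

primrec phi_from ::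
  "('a, 'b, 'y) scheme \<Rightarrow> nat \<Rightarrow> nat \<Rightarrow> ('a, 'b, 'y) pt \<Rightarrow> ('a, 'b, 'y) pt" where
  "phi_from S m 0 = id"
| "phi_from S m (Suc k) = phi_step S (m + k) \<circ> phi_from S m k"

definition phi_nm ::
  "('a, 'b, 'y) scheme \<Rightarrow> nat \<Rightarrow> nat \<Rightarrow> ('a, 'b, 'y) pt \<Rightarrow> ('a, 'b, 'y) pt" where
  "phi_nm S n m = phi_from S m (n - m)"

text \<open>
  \<open>pi_pq S p q u x\<close> is \<open>\<pi>\<^sub>p\<^sub>,\<^sub>q(y\<^sub>1, \<dots>, y\<^sub>p, x)\<close>.  Sequences are indexed from \<open>0\<close>, so \<open>y\<^sub>i\<close> is \<open>u (i - 1)\<close>;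
  a point of \<open>Y\<^sup>p\<close> is given by a sequence of which only the first \<open>p\<close> entries are used.
\<close>

fun pi_pq ::
  "('a, 'b, 'y) scheme \<Rightarrow> nat \<Rightarrow> nat \<Rightarrow> (nat \<Rightarrow> 'y) \<Rightarrow> ('a, 'b, 'y) pt \<Rightarrow> ('a, 'b, 'y) pt" where
  "pi_pq S 0 q u x = x"
| "pi_pq S (Suc p) q u x = pi_pq S p (Suc q) u (pi1 S q (u p, x))"


subsection \<open>The limit space\<close>

definition cell :: "('a, 'b, 'y) scheme \<Rightarrow> nat \<Rightarrow> (nat \<Rightarrow> 'y) \<Rightarrow> ('a, 'b, 'y) pt set" where
  "cell S p u = {pi_pq S p 0 u x | x. x \<in> topspace (XX S 0)}"

definition YN :: "('a, 'b, 'y) scheme \<Rightarrow> (nat \<Rightarrow> 'y) topology" where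
  "YN S = product_topology (\<lambda>_. YY S) UNIV"

definition Gam :: "('a, 'b, 'y) scheme \<Rightarrow> nat \<Rightarrow> ('a, 'b, 'y) pt \<Rightarrow> (nat \<Rightarrow> 'y) set" where
  "Gam S n x = {u \<in> topspace (YN S). \<forall>p\<ge>n. phi_nm S p n x \<in> cell S p u}"

definition R_rel :: "('a, 'b, 'y) scheme \<Rightarrow> ((nat \<Rightarrow> 'y) \<times> (nat \<Rightarrow> 'y)) set" where
  "R_rel S = {(u, v). u \<in> topspace (YN S) \<and> v \<in> topspace (YN S) \<and>
     (u = v \<or> (\<exists>n. \<exists>x \<in> topspace (XX S n). u \<in> Gam S n x \<and> v \<in> Gam S n x))}"

definition R_inf :: "('a, 'b, 'y) scheme \<Rightarrow> ((nat \<Rightarrow> 'y) \<times> (nat \<Rightarrow> 'y)) set" where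
  "R_inf S = \<Inter>{E. equiv (topspace (YN S)) E \<and> R_rel S \<subseteq> E}"

definition piN :: "('a, 'b, 'y) scheme \<Rightarrow> (nat \<Rightarrow> 'y) \<Rightarrow> (nat \<Rightarrow> 'y) set" where
  "piN S u = R_inf S `` {u}"

definition X_inf :: "('a, 'b, 'y) scheme \<Rightarrow> (nat \<Rightarrow> 'y) set topology" where
  "X_inf S = quot_top (YN S) (piN S)"

definition phi_inf :: "('a, 'b, 'y) scheme \<Rightarrow> nat \<Rightarrow> ('a, 'b, 'y) pt \<Rightarrow> (nat \<Rightarrow> 'y) set" where
  "phi_inf S n x = the_elem (piN S ` Gam S n x)"

text \<open>\<open>\<phi>\<^sub>\<infinity>\<^sub>,\<^sub>0\<close> on the original space \<open>X\<^sub>0\<close> rather than on its copy \<open>XX S 0\<close>.\<close>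

definition phi_inf0 :: "('a, 'b, 'y) scheme \<Rightarrow> 'a \<Rightarrow> (nat \<Rightarrow> 'y) set" where
  "phi_inf0 S = phi_inf S 0 \<circ> Pt0"

definition fully_injective :: "('a, 'b, 'y) scheme \<Rightarrow> bool" where
  "fully_injective S \<longleftrightarrow> (\<forall>n. inj_on (phi_inf S n) (topspace (XX S n)))"

definition R_hat :: "('a, 'b, 'y) scheme \<Rightarrow> ((nat \<Rightarrow> 'y) \<times> (nat \<Rightarrow> 'y)) set" where
  "R_hat S = {(u, v). u \<in> topspace (YN S) \<and> v \<in> topspace (YN S) \<and>
     (u 0 = v 0 \<and>
        (u \<circ> Suc = v \<circ> Suc \<or>
         (\<exists>n. \<exists>x \<in> topspace (XX S n). u \<circ> Suc \<in> Gam S n x \<and> v \<circ> Suc \<in> Gam S n x)) \<or>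
      (\<exists>x \<in> topspace (X0 S). \<exists>x' \<in> topspace (X0 S).
         proj S (u 0, x) = proj S (v 0, x') \<and>
         u \<circ> Suc \<in> Gam S 0 (Pt0 x) \<and> v \<circ> Suc \<in> Gam S 0 (Pt0 x')))}"

end

theory Submission
  imports Defs
begin

text \<open>
  Write \<open>R\<close> for \<open>R_rel S\<close>.  Since \<open>\<Gamma>\<^sub>n\<^sub>+\<^sub>1(\<phi>\<^sub>n\<^sub>+\<^sub>1\<^sub>,\<^sub>n(x)) = \<Gamma>\<^sub>n(x)\<close>, full injectivity makes \<open>R\<close> transitive,
  so \<open>R_inf S = R\<close>.  Let \<open>u\<close> have first entry \<open>y\<close> and tail \<open>u'\<close>.  A compactness argument on \<open>X\<^sub>0\<close> shows
  that \<open>u \<in> \<Gamma>\<^sub>n\<^sub>+\<^sub>1(x)\<close> iff \<open>x = \<pi>\<^sub>1\<^sub>,\<^sub>n(y, z)\<close> and \<open>u' \<in> \<Gamma>\<^sub>n(z)\<close> for some \<open>z\<close>; comparing two such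
  representations of the same \<open>x\<close> gives \<open>R = R_hat S\<close>.

  The point \<open>\<phi>\<^sub>p\<^sub>,\<^sub>0(a)\<close> lies in the cell of \<open>u\<close> iff there is a chain \<open>a = a\<^sub>0, \<dots>, a\<^sub>p\<close> in \<open>X\<^sub>0\<close> with
  \<open>\<phi>(a\<^sub>i) = \<pi>(y\<^sub>i\<^sub>+\<^sub>1, a\<^sub>i\<^sub>+\<^sub>1)\<close>.  This is a closed condition on \<open>(a, u)\<close>, so the topologies of \<open>X\<^sub>n\<close> for \<open>n \<ge> 2\<close>
  play no role.  By \<open>R = R_hat S\<close>, a pair in the closure of \<open>R\<close> either satisfies the closed clause (ii) of
  \<open>R_hat\<close> or has equal first entries and tails again in the closure of \<open>R\<close>; iterating, \<open>R\<close> is closed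
  and \<open>X\<^sub>\<infinity>\<close> is Hausdorff.  The isomorphism is induced by prepending an entry to a sequence.
\<close>

section \<open>Closed sets, projections along compact factors, and quotients of compact Hausdorff
  spaces\<close>

lemma closedin_Bex_compact:
  assumes "compact_space Y"
    and "closedin (prod_topology X Y) {z \<in> topspace (prod_topology X Y). P (fst z) (snd z)}"
  shows "closedin X {x \<in> topspace X. \<exists>y\<in>topspace Y. P x y}"
proof -
  have "{x \<in> topspace X. \<exists>y\<in>topspace Y. P x y} =
      fst ` {z \<in> topspace (prod_topology X Y). P (fst z) (snd z)}"
    by force
  moreover have "closed_map (prod_topology X Y) X fst"
    by (rule Abstract_Topological_Spaces.closed_map_fst[OF assms(1)])
  ultimately show ?thesis
    using assms(2) unfolding closed_map_def by presburger
qed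

lemma closedin_conj:
  "closedin X {x \<in> topspace X. P x} \<Longrightarrow> closedin X {x \<in> topspace X. Q x} \<Longrightarrow>
    closedin X {x \<in> topspace X. P x \<and> Q x}"
  by (drule (1) closedin_Int) (simp add: Collect_conj_eq Int_ac)

lemma compact_space_quotient_map_image:
  "quotient_map X Y f \<Longrightarrow> compact_space X \<Longrightarrow> compact_space Y"
  using image_compactin[OF _ quotient_imp_continuous_map]
  by (metis compact_space_def quotient_imp_surjective_map)

text \<open>The saturation of a closed set \<open>C\<close> is the second projection of
  \<open>r \<inter> (C \<times> topspace X)\<close>, and projecting along a compact factor is a
  closed map. So the quotient map is closed; it carries normality and closed points to the quotient,
  which is therefore Hausdorff.\<close>

lemma Hausdorff_space_quot_top_closed_equiv:
  assumes X: "compact_space X" "Hausdorff_space X"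
    and r: "equiv (topspace X) r" "closedin (prod_topology X X) r"
  shows "Hausdorff_space (quot_top X (\<lambda>x. r `` {x}))" (is "Hausdorff_space (quot_top X ?q)")
proof -
  have eq: "?q x = ?q y \<longleftrightarrow> (x, y) \<in> r" if "x \<in> topspace X" "y \<in> topspace X" for x y
    using eq_equiv_class_iff[OF r(1) that] .
  have qm: "quotient_map X (quot_top X ?q) ?q" by (rule quotient_map_quot_top)
  have closed: "closed_map X (quot_top X ?q) ?q"
    unfolding closed_map_def
  proof (intro allI impI)
    fix C assume C: "closedin X C"
    note CX = closedin_subset[OF C]
    have rsub: "r \<subseteq> topspace X \<times> topspace X" using closedin_subset[OF r(2)] by simp
    have "closedin (prod_topology X X) (r \<inter> (C \<times> topspace X))"
      using C r(2) by (intro closedin_Int) (auto simp: closedin_prod_Times_iff)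
    then have "closedin X (snd ` (r \<inter> (C \<times> topspace X)))"
      using Abstract_Topological_Spaces.closed_map_snd[OF X(1)] unfolding closed_map_def by blast
    also have "snd ` (r \<inter> (C \<times> topspace X)) = {x \<in> topspace X. \<exists>c\<in>C. (c, x) \<in> r}"
      using rsub by force
    also have "\<dots> = {x \<in> topspace X. ?q x \<in> ?q ` C}"
    proof -
      have "(c, x) \<in> r \<longleftrightarrow> ?q x = ?q c" if "x \<in> topspace X" "c \<in> C" for x c
        using eq[of c x] that CX by (metis subsetD)
      then show ?thesis unfolding image_iff by blast
    qed
    finally show "closedin (quot_top X ?q) (?q ` C)"
      using qm image_mono[OF CX, of ?q] unfolding quotient_map_closedin by auto
  qed
  have normal: "normal_space (quot_top X ?q)"
    using normal_space_continuous_closed_map_image[OF _ quotient_imp_continuous_map[OF qm] closed]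
      compact_Hausdorff_or_regular_imp_normal_space[OF X(1)] X(2)
    by (simp add: topspace_quot_top)
  have "t1_space (quot_top X ?q)"
    unfolding t1_space_closedin_singleton
  proof
    fix c assume "c \<in> topspace (quot_top X ?q)"
    then obtain x where x: "x \<in> topspace X" "c = ?q x" by (auto simp: topspace_quot_top)
    have "closedin (quot_top X ?q) (?q ` {x})"
      using closed closedin_Hausdorff_singleton[OF X(2) x(1)] unfolding closed_map_def by blast
    then show "closedin (quot_top X ?q) {c}" using x by simp
  qed
  then show ?thesis using normal normal_t1_imp_Hausdorff_space by blast
qed

section \<open>The tower and its connecting maps\<close>

locale sim_scheme =
  fixes S :: "('a, 'b, 'y) scheme"
  assumes scheme: "similarity_scheme S"
begin

abbreviation "TY \<equiv> topspace (YY S)"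
abbreviation "T0 \<equiv> topspace (X0 S)"
abbreviation "TN \<equiv> topspace (YN S)"
abbreviation "T n \<equiv> topspace (XX S n)"
text \<open>This is \<open>\<phi>\<^sub>n\<^sub>,\<^sub>0\<close>, with the original
  \<open>X\<^sub>0\<close> rather than its copy \<open>XX S 0\<close> as domain.\<close>

abbreviation "iota n \<equiv> snd (tower S n)"

lemma phi_proj_ex: "a \<in> T0 \<Longrightarrow> \<exists>y\<in>TY. \<exists>b\<in>T0. phi S a = proj S (y, b)"
proof -
  assume "a \<in> T0"
  then have "phi S a \<in> topspace (X1 S)"
    using scheme by (auto simp: similarity_scheme_def continuous_map_def)
  also have "topspace (X1 S) = proj S ` (TY \<times> T0)"
    using scheme by (simp add: similarity_scheme_def)
  finally show ?thesis by auto
qed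

lemma inj_phi: "inj_on (phi S) T0"
  using scheme by (simp add: similarity_scheme_def)

lemma T_0: "T 0 = Pt0 ` T0"
  by (simp add: XX_def topspace_quot_top)

lemma T_Suc: "T (Suc n) = pi1 S n ` (TY \<times> T n)"
proof (cases n)
  case 0
  have "topspace (X1 S) = proj S ` (TY \<times> T0)"
    using scheme by (simp add: similarity_scheme_def)
  moreover have "TY \<times> T 0 = (\<lambda>(y, a). (y, Pt0 a)) ` (TY \<times> T0)"
    by (auto simp: T_0)
  ultimately show ?thesis
    by (simp add: 0 XX_def topspace_quot_top image_image case_prod_unfold)
next
  case (Suc m)
  have "pi1 S n = code \<circ> hat_proj S (tower S n)"
    by (auto simp: Suc fun_eq_iff)
  then show ?thesis
    by (simp add: Suc XX_def topspace_quot_top Phi_def hat_space_def image_image comp_def)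
qed

lemma pi1_in: "y \<in> TY \<Longrightarrow> x \<in> T n \<Longrightarrow> pi1 S n (y, x) \<in> T (Suc n)"
  by (auto simp: T_Suc)

lemma TSucE:
  assumes "w \<in> T (Suc n)"
  obtains y x where "y \<in> TY" "x \<in> T n" "w = pi1 S n (y, x)"
  using assms by (auto simp: T_Suc)

text \<open>For \<open>n > 0\<close> the values of \<open>pi1 S n\<close> name classes of
  \<open>hat_rel\<close>, which is an equivalence relation because \<open>iota n\<close> is
  injective. Injectivity stays a hypothesis here, since \<open>iota_aux\<close> proves it by an
  induction that uses this lemma.\<close>

lemma pi1_eq_iff_aux:
  assumes inj: "inj_on (iota n) T0"
    and "y \<in> TY" "y' \<in> TY" "x \<in> T n" "x' \<in> T n"
  shows "pi1 S n (y, x) = pi1 S n (y', x') \<longleftrightarrow> (y, x) = (y', x') \<or>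
    (\<exists>a\<in>T0. \<exists>a'\<in>T0. x = iota n a \<and> x' = iota n a' \<and> proj S (y, a) = proj S (y', a'))"
proof (cases n)
  case 0
  then show ?thesis using assms by (auto simp: T_0)
next
  case (Suc m)
  let ?P = "tower S n" let ?A = "topspace (prod_topology (YY S) (fst ?P))"
  have eq: "equiv ?A (hat_rel S ?P)" by (rule equiv_hat_rel[OF inj])
  have mem: "(y, x) \<in> ?A" "(y', x') \<in> ?A" using assms by (auto simp: XX_def)
  have "pi1 S n (y, x) = pi1 S n (y', x') \<longleftrightarrow>
      code (hat_proj S ?P (y, x)) = code (hat_proj S ?P (y', x'))"
    by (simp add: Suc)
  also have "\<dots> \<longleftrightarrow> hat_proj S ?P (y, x) = hat_proj S ?P (y', x')"
    using inj_on_code[OF eq] mem by (intro inj_on_eq_iff) (auto simp: hat_proj_def quotientI)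
  also have "\<dots> \<longleftrightarrow> ((y, x), (y', x')) \<in> hat_rel S ?P"
    unfolding hat_proj_def by (rule eq_equiv_class_iff[OF eq mem])
  finally show ?thesis using mem unfolding hat_rel_def by simp
qed

text \<open>The description by \<open>THE\<close> is meaningful because two representations of one
  point of \<open>X\<^sub>1\<close> yield pairs related by \<open>hat_rel\<close>.\<close>

lemma hat_emb1_proj:
  assumes inj: "inj_on (snd P) T0" and mem: "snd P ` T0 \<subseteq> topspace (fst P)"
    and y: "y \<in> TY" and b: "b \<in> T0"
  shows "hat_emb1 S P (proj S (y, b)) = hat_proj S P (y, snd P b)"
  unfolding hat_emb1_def
proof (rule the_equality)
  fix w assume "\<exists>y'\<in>TY. \<exists>x\<in>T0. proj S (y, b) = proj S (y', x) \<and> w = hat_proj S P (y', snd P x)"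
  then obtain y' x where *: "y' \<in> TY" "x \<in> T0" "proj S (y, b) = proj S (y', x)"
    "w = hat_proj S P (y', snd P x)" by auto
  then have "((y', snd P x), (y, snd P b)) \<in> hat_rel S P"
    using y b mem unfolding hat_rel_def by fastforce
  then show "w = hat_proj S P (y, snd P b)"
    using * equiv_class_eq[OF equiv_hat_rel[OF inj]] by (simp add: hat_proj_def)
qed (use y b in auto)

text \<open>One recursion for \<open>\<phi>\<^sub>n\<^sub>+\<^sub>1\<^sub>,\<^sub>0\<close> that
  covers the separate clauses of \<open>tower\<close>; later arguments use it in place of the
  definition.\<close>

lemma iota_Suc_aux:
  assumes inj: "inj_on (iota n) T0" and mem: "iota n ` T0 \<subseteq> T n"
    and "y \<in> TY" "b \<in> T0" "phi S a = proj S (y, b)"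
  shows "iota (Suc n) a = pi1 S n (y, iota n b)"
proof (cases n)
  case 0
  then show ?thesis using assms by auto
next
  case (Suc m)
  then show ?thesis
    using hat_emb1_proj[OF inj _ assms(3,4)] mem assms(5) by (simp add: Phi_def XX_def)
qed

lemma iota_aux: "inj_on (iota n) T0 \<and> iota n ` T0 \<subseteq> T n"
proof (induction n)
  case 0
  then show ?case by (auto simp: T_0 intro: inj_onI)
next
  case (Suc n)
  note inj = conjunct1[OF Suc] and mem = conjunct2[OF Suc]
  show ?case
  proof (intro conjI inj_onI subsetI)
    fix a a' assume a: "a \<in> T0" "a' \<in> T0" "iota (Suc n) a = iota (Suc n) a'"
    obtain y b where b: "y \<in> TY" "b \<in> T0" "phi S a = proj S (y, b)"
      using phi_proj_ex a by blast
    obtain y' b' where b': "y' \<in> TY" "b' \<in> T0" "phi S a' = proj S (y', b')"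
      using phi_proj_ex a by blast
    have "pi1 S n (y, iota n b) = pi1 S n (y', iota n b')"
      using a(3) iota_Suc_aux[OF inj mem b] iota_Suc_aux[OF inj mem b'] by simp
    moreover have "iota n b \<in> T n" "iota n b' \<in> T n" using mem b b' by auto
    ultimately have "proj S (y, b) = proj S (y', b')"
      using pi1_eq_iff_aux[OF inj, of y y' "iota n b" "iota n b'"] b b' inj_on_eq_iff[OF inj]
      by (metis Pair_inject)
    then show "a = a'" using inj_onD[OF inj_phi] a b b' by simp
  next
    fix x assume "x \<in> iota (Suc n) ` T0"
    then obtain a where a: "a \<in> T0" "x = iota (Suc n) a" by auto
    obtain y b where b: "y \<in> TY" "b \<in> T0" "phi S a = proj S (y, b)"
      using phi_proj_ex a by blast
    show "x \<in> T (Suc n)"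
      using a(2) iota_Suc_aux[OF inj mem b] b mem pi1_in by auto
  qed
qed

lemma inj_iota: "inj_on (iota n) T0" and iota_in: "a \<in> T0 \<Longrightarrow> iota n a \<in> T n"
  using iota_aux by auto

lemma iota_eq_iff: "a \<in> T0 \<Longrightarrow> b \<in> T0 \<Longrightarrow> iota n a = iota n b \<longleftrightarrow> a = b"
  using inj_on_eq_iff[OF inj_iota] .

lemma iota_Suc:
  "y \<in> TY \<Longrightarrow> b \<in> T0 \<Longrightarrow> phi S a = proj S (y, b) \<Longrightarrow> iota (Suc n) a = pi1 S n (y, iota n b)"
  by (rule iota_Suc_aux) (use iota_aux in auto)

lemmas pi1_eq_iff = pi1_eq_iff_aux[OF inj_iota]

declare pi1.simps(2) [simp del] tower.simps(3) [simp del]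

text \<open>The claims need a joint induction. The \<open>THE\<close> in
  \<open>phi_step S (Suc n)\<close> is independent of the representative because
  \<open>phi_step S n\<close> is compatible with the embeddings of \<open>X\<^sub>0\<close>; the
  resulting equation in turn gives the first two claims one level higher.\<close>

lemma phi_step_aux:
  "(\<forall>x\<in>T n. phi_step S n x \<in> T (Suc n)) \<and> (\<forall>a\<in>T0. phi_step S n (iota n a) = iota (Suc n) a) \<and>
   (\<forall>y\<in>TY. \<forall>x\<in>T n. phi_step S (Suc n) (pi1 S n (y, x)) = pi1 S (Suc n) (y, phi_step S n x))"
proof (induction n)
  have key: "phi_step S (Suc n) (pi1 S n (y, x)) = pi1 S (Suc n) (y, phi_step S n x)"
    if 1: "\<forall>x\<in>T n. phi_step S n x \<in> T (Suc n)"
      and 2: "\<forall>a\<in>T0. phi_step S n (iota n a) = iota (Suc n) a"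
      and yx: "y \<in> TY" "x \<in> T n" for n y x
    unfolding phi_step.simps(2)
  proof (rule the_equality)
    fix v assume "\<exists>y'\<in>TY. \<exists>x'\<in>T n. pi1 S n (y, x) = pi1 S n (y', x') \<and>
      v = pi1 S (Suc n) (y', phi_step S n x')"
    then obtain y' x' where *: "y' \<in> TY" "x' \<in> T n" "pi1 S n (y, x) = pi1 S n (y', x')"
      "v = pi1 S (Suc n) (y', phi_step S n x')" by auto
    have "(y, x) = (y', x') \<or>
      (\<exists>a\<in>T0. \<exists>a'\<in>T0. x = iota n a \<and> x' = iota n a' \<and> proj S (y, a) = proj S (y', a'))"
      using pi1_eq_iff yx * by metis
    then have "pi1 S (Suc n) (y, phi_step S n x) = pi1 S (Suc n) (y', phi_step S n x')"
      using pi1_eq_iff[of y y' "phi_step S n x" "Suc n" "phi_step S n x'"] yx *(1,2) 1 2 by blast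
    then show "v = pi1 S (Suc n) (y, phi_step S n x)" using * by simp
  qed (use yx in auto)
  case 0
  have 1: "\<forall>x\<in>T 0. phi_step S 0 x \<in> T (Suc 0)"
  proof
    fix x assume "x \<in> T 0"
    then obtain a where a: "a \<in> T0" "x = Pt0 a" by (auto simp: T_0)
    show "phi_step S 0 x \<in> T (Suc 0)" using iota_in[OF a(1), of "Suc 0"] a by simp
  qed
  have 2: "\<forall>a\<in>T0. phi_step S 0 (iota 0 a) = iota (Suc 0) a" by simp
  show ?case using 1 2 key[OF 1 2] by blast
  fix n
  case (Suc n)
  have 1: "\<forall>x\<in>T (Suc n). phi_step S (Suc n) x \<in> T (Suc (Suc n))"
  proof
    fix x assume "x \<in> T (Suc n)"
    then obtain y z where "y \<in> TY" "z \<in> T n" "x = pi1 S n (y, z)" by (rule TSucE)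
    then show "phi_step S (Suc n) x \<in> T (Suc (Suc n))" 
      using Suc pi1_in[of y "phi_step S n z" "Suc n"] by metis
  qed
  have 2: "\<forall>a\<in>T0. phi_step S (Suc n) (iota (Suc n) a) = iota (Suc (Suc n)) a"
  proof
    fix a assume "a \<in> T0"
    then obtain y b where b: "y \<in> TY" "b \<in> T0" "phi S a = proj S (y, b)"
      using phi_proj_ex by blast
    show "phi_step S (Suc n) (iota (Suc n) a) = iota (Suc (Suc n)) a"
      using Suc iota_Suc[OF b] iota_in b by metis
  qed
  show ?case using 1 2 key[OF 1 2] by blast
qed

lemma phi_step_in: "x \<in> T n \<Longrightarrow> phi_step S n x \<in> T (Suc n)"
  and phi_step_iota: "a \<in> T0 \<Longrightarrow> phi_step S n (iota n a) = iota (Suc n) a"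
  and phi_step_pi1:
    "y \<in> TY \<Longrightarrow> x \<in> T n \<Longrightarrow> phi_step S (Suc n) (pi1 S n (y, x)) = pi1 S (Suc n) (y, phi_step S n x)"
  using phi_step_aux by blast+

declare phi_step.simps(2) [simp del]

lemma inj_phi_step: "inj_on (phi_step S n) (T n)"
proof (induction n)
  case 0
  show ?case using inj_onD[OF inj_phi] by (auto simp: T_0 inj_on_def)
next
  case (Suc n)
  \<comment> \<open>A point that lands in the image of \<open>X\<^sub>0\<close> already came from
    there. This lets an identification made at level \<open>Suc n\<close> be pulled back to level
    \<open>n\<close>.\<close>
  have refl: "x = iota n a" if "x \<in> T n" "a \<in> T0" "phi_step S n x = iota (Suc n) a" for x a
    using inj_onD[OF Suc] that iota_in phi_step_iota by metis
  show ?case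
  proof (rule inj_onI)
    fix w w' assume w: "w \<in> T (Suc n)" "w' \<in> T (Suc n)" "phi_step S (Suc n) w = phi_step S (Suc n) w'"
    obtain y x where x: "y \<in> TY" "x \<in> T n" "w = pi1 S n (y, x)" using w TSucE by blast
    obtain y' x' where x': "y' \<in> TY" "x' \<in> T n" "w' = pi1 S n (y', x')" using w TSucE by blast
    have "pi1 S (Suc n) (y, phi_step S n x) = pi1 S (Suc n) (y', phi_step S n x')"
      using w x x' phi_step_pi1 by metis
    then consider "y = y'" "phi_step S n x = phi_step S n x'" |
       a a' where "a \<in> T0" "a' \<in> T0" "phi_step S n x = iota (Suc n) a"
       "phi_step S n x' = iota (Suc n) a'" "proj S (y, a) = proj S (y', a')"
      using pi1_eq_iff[of y y' "phi_step S n x" "Suc n" "phi_step S n x'"] x x' phi_step_in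
      by blast
    then show "w = w'"
    proof cases
      case 1
      then show ?thesis using x x' inj_onD[OF Suc] by blast
    next
      case 2
      then have "x = iota n a" "x' = iota n a'" using refl x x' by auto
      then show ?thesis using 2 x x' pi1_eq_iff by metis
    qed
  qed
qed

lemma iota_of_phi_step:
  "x \<in> T n \<Longrightarrow> a \<in> T0 \<Longrightarrow> phi_step S n x = iota (Suc n) a \<Longrightarrow> x = iota n a"
  using inj_onD[OF inj_phi_step] iota_in phi_step_iota by metis

lemma phi_from_in: "x \<in> T n \<Longrightarrow> phi_from S n k x \<in> T (n + k)"
  by (induction k) (auto simp: phi_step_in)

lemma phi_from_iota: "a \<in> T0 \<Longrightarrow> phi_from S n k (iota n a) = iota (n + k) a"
  by (induction k) (auto simp: phi_step_iota)

lemma iota_of_phi_from: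
  "x \<in> T n \<Longrightarrow> a \<in> T0 \<Longrightarrow> phi_from S n k x = iota (n + k) a \<Longrightarrow> x = iota n a"
  by (induction k) (auto dest: iota_of_phi_step[OF phi_from_in])

lemma phi_from_pi1:
  "y \<in> TY \<Longrightarrow> x \<in> T n \<Longrightarrow> phi_from S (Suc n) k (pi1 S n (y, x)) = pi1 S (n + k) (y, phi_from S n k x)"
  by (induction k) (auto simp: phi_step_pi1 phi_from_in)

lemma phi_from_phi_step: "phi_from S (Suc n) k (phi_step S n x) = phi_from S n (Suc k) x"
  by (induction k) auto

section \<open>Cells and the sets \<open>Gam S n x\<close>\<close>

lemma TN_iff: "u \<in> TN \<longleftrightarrow> (\<forall>i. u i \<in> TY)"
  by (auto simp: YN_def PiE_iff)

lemma tail_in: "u \<in> TN \<Longrightarrow> u \<circ> Suc \<in> TN"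
  by (simp add: TN_iff)

text \<open>The definition peels off the last entry of the word; this form peels off the first, so
  that cells can be treated by recursion on the tail.\<close>

lemma pi_pq_Suc: "pi_pq S (Suc p) q u x = pi1 S (p + q) (u 0, pi_pq S p q (u \<circ> Suc) x)"
  by (induction p arbitrary: q x) auto

lemma cell_0: "cell S 0 u = T 0"
  by (auto simp: cell_def)

lemma cell_Suc: "cell S (Suc p) u = (\<lambda>x. pi1 S p (u 0, x)) ` cell S p (u \<circ> Suc)"
  unfolding cell_def pi_pq_Suc by auto

lemma cell_subset: "u \<in> TN \<Longrightarrow> cell S p u \<subseteq> T p"
proof (induction p arbitrary: u)
  case (Suc p)
  have "u 0 \<in> TY" using Suc.prems by (simp add: TN_iff)
  then show ?case
    using pi1_in Suc.IH[OF tail_in[OF Suc.prems]] unfolding cell_Suc by blast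
qed (simp add: cell_0)

text \<open>The second alternative accounts for points of the image of \<open>X\<^sub>0\<close>,
  where the pair witnessing membership in the cell may differ from the given representative
  \<open>(y, x)\<close>.\<close>

lemma pi1_in_cell_Suc:
  assumes "u \<in> TN" "y \<in> TY" "x \<in> T p"
  shows "pi1 S p (y, x) \<in> cell S (Suc p) u \<longleftrightarrow> y = u 0 \<and> x \<in> cell S p (u \<circ> Suc) \<or>
    (\<exists>a\<in>T0. \<exists>b\<in>T0. x = iota p a \<and> proj S (y, a) = proj S (u 0, b) \<and> iota p b \<in> cell S p (u \<circ> Suc))"
    (is "?l \<longleftrightarrow> ?r")
proof
  assume ?l
  then obtain z where z: "z \<in> cell S p (u \<circ> Suc)" "pi1 S p (y, x) = pi1 S p (u 0, z)"
    by (auto simp: cell_Suc)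
  have "z \<in> T p" "u 0 \<in> TY" using z(1) assms cell_subset[OF tail_in] by (auto simp: TN_iff)
  then show ?r using z pi1_eq_iff assms by blast
next
  assume r: ?r
  have "u 0 \<in> TY" using assms by (auto simp: TN_iff)
  from r show ?l
  proof (elim disjE bexE conjE)
    fix a b assume "a \<in> T0" "b \<in> T0" "x = iota p a" "proj S (y, a) = proj S (u 0, b)"
      and b: "iota p b \<in> cell S p (u \<circ> Suc)"
    then have "pi1 S p (y, x) = pi1 S p (u 0, iota p b)"
      using pi1_eq_iff[OF assms(2) \<open>u 0 \<in> TY\<close> assms(3) iota_in] by blast
    then show ?l using b by (auto simp: cell_Suc)
  qed (auto simp: cell_Suc)
qed

text \<open>Cells shrink along the tower. The alternatives of \<open>pi1_in_cell_Suc\<close> descend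
  one level each: the first by induction on the tail, the second because \<open>phi_step\<close>
  reflects the image of \<open>X\<^sub>0\<close>.\<close>

lemma cell_of_phi_step:
  "u \<in> TN \<Longrightarrow> w \<in> T p \<Longrightarrow> phi_step S p w \<in> cell S (Suc p) u \<Longrightarrow> w \<in> cell S p u"
proof (induction p arbitrary: u w)
  case 0
  then show ?case by (simp add: cell_0)
next
  case (Suc p)
  obtain y x where x: "y \<in> TY" "x \<in> T p" "w = pi1 S p (y, x)" using Suc.prems TSucE by blast
  have *: "pi1 S (Suc p) (y, phi_step S p x) \<in> cell S (Suc (Suc p)) u"
    using Suc.prems x phi_step_pi1 by metis
  have t: "u \<circ> Suc \<in> TN" using Suc.prems tail_in by blast
  consider "y = u 0" "phi_step S p x \<in> cell S (Suc p) (u \<circ> Suc)" |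
    a b where "a \<in> T0" "b \<in> T0" "phi_step S p x = iota (Suc p) a" "proj S (y, a) = proj S (u 0, b)"
      "iota (Suc p) b \<in> cell S (Suc p) (u \<circ> Suc)"
    using * unfolding pi1_in_cell_Suc[OF Suc.prems(1) x(1) phi_step_in[OF x(2)]] by blast
  then show ?case
  proof cases
    case 1
    then show ?thesis unfolding x(3) pi1_in_cell_Suc[OF Suc.prems(1) x(1,2)]
      using Suc.IH[OF t x(2)] by blast
  next
    case 2
    then have "x = iota p a" using iota_of_phi_step x by blast
    moreover have "iota p b \<in> cell S p (u \<circ> Suc)"
      using Suc.IH[OF t iota_in] phi_step_iota 2 by metis
    ultimately show ?thesis unfolding x(3) pi1_in_cell_Suc[OF Suc.prems(1) x(1,2)]
      using 2 by blast
  qed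
qed

text \<open>Writing \<open>phi S a\<close> as some \<open>proj S (y, c)\<close> reduces membership
  to a condition on \<open>X\<^sub>0\<close> and \<open>X\<^sub>1\<close>. Unfolding the recursion
  produces the chains in \<open>X\<^sub>0\<close>.\<close>

lemma iota_Suc_in_cell:
  assumes "u \<in> TN" "a \<in> T0"
  shows "iota (Suc p) a \<in> cell S (Suc p) u \<longleftrightarrow>
    (\<exists>b\<in>T0. phi S a = proj S (u 0, b) \<and> iota p b \<in> cell S p (u \<circ> Suc))"
proof -
  obtain y c where c: "y \<in> TY" "c \<in> T0" "phi S a = proj S (y, c)"
    using phi_proj_ex assms by blast
  show ?thesis
    unfolding iota_Suc[OF c] pi1_in_cell_Suc[OF assms(1) c(1) iota_in[OF c(2)]]
    using c iota_eq_iff[OF c(2)] by metis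
qed

lemma Gam_iff: "u \<in> Gam S n x \<longleftrightarrow> u \<in> TN \<and> (\<forall>k. phi_from S n k x \<in> cell S (n + k) u)"
  unfolding Gam_def phi_nm_def
  by (auto, metis le_add1 add_diff_cancel_left', metis le_add_diff_inverse)

lemma Gam_iota: "a \<in> T0 \<Longrightarrow> u \<in> Gam S 0 (Pt0 a) \<longleftrightarrow> u \<in> TN \<and> (\<forall>p. iota p a \<in> cell S p u)"
  using phi_from_iota[of a 0] by (simp add: Gam_iff)

text \<open>The left-hand side omits only the condition at level \<open>n\<close>, which
  \<open>cell_of_phi_step\<close> recovers from the one at level \<open>Suc n\<close>.\<close>

lemma Gam_phi_step: "x \<in> T n \<Longrightarrow> Gam S (Suc n) (phi_step S n x) = Gam S n x"
proof (intro set_eqI iffI)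
  fix u assume x: "x \<in> T n" and u: "u \<in> Gam S (Suc n) (phi_step S n x)"
  have 1: "phi_from S n (Suc k) x \<in> cell S (n + Suc k) u" for k
    using u by (simp add: Gam_iff phi_from_phi_step)
  have "phi_from S n k x \<in> cell S (n + k) u" for k
  proof (cases k)
    case 0
    then show ?thesis using 1[of 0] cell_of_phi_step[of u x n] x u by (simp add: Gam_iff)
  qed (use 1 in metis)
  then show "u \<in> Gam S n x" using u by (simp add: Gam_iff)
next
  fix u assume x: "x \<in> T n" and u: "u \<in> Gam S n x"
  have "phi_from S n (Suc k) x \<in> cell S (n + Suc k) u" for k
    using u unfolding Gam_iff by blast
  then show "u \<in> Gam S (Suc n) (phi_step S n x)"
    using u by (simp add: Gam_iff phi_from_phi_step)
qed

lemma Gam_phi_from: "x \<in> T n \<Longrightarrow> Gam S (n + k) (phi_from S n k x) = Gam S n x"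
  by (induction k) (auto simp: Gam_phi_step phi_from_in)

lemma Gam_iota_n: "a \<in> T0 \<Longrightarrow> Gam S n (iota n a) = Gam S 0 (Pt0 a)"
  using Gam_phi_from[of "Pt0 a" 0 n] phi_from_iota[of a 0 n] by (simp add: T_0)

lemma Gam_pi1_I:
  assumes "u \<in> TN" "z \<in> T n" "u \<circ> Suc \<in> Gam S n z"
  shows "u \<in> Gam S (Suc n) (pi1 S n (u 0, z))"
proof -
  have "u 0 \<in> TY" using assms by (simp add: TN_iff)
  then show ?thesis using assms by (simp add: Gam_iff phi_from_pi1 cell_Suc)
qed

section \<open>Prepending an entry, and nonemptiness of the sets
  \<open>\<Gamma>\<^sub>0(x)\<close>\<close>

definition cons :: "'y \<Rightarrow> (nat \<Rightarrow> 'y) \<Rightarrow> nat \<Rightarrow> 'y" where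
  "cons y u = case_nat y u"

lemma cons_simps [simp]: "cons y u 0 = y" "cons y u \<circ> Suc = u" "cons (u 0) (u \<circ> Suc) = u"
  by (auto simp: cons_def fun_eq_iff split: nat.splits)

lemma cons_in: "y \<in> TY \<Longrightarrow> u \<in> TN \<Longrightarrow> cons y u \<in> TN"
  by (auto simp: TN_iff cons_def split: nat.splits)

lemma Gam_0_ex: assumes "a \<in> T0" shows "\<exists>u. u \<in> Gam S 0 (Pt0 a)"
proof -
  have "\<forall>a\<in>T0. \<exists>q. fst q \<in> TY \<and> snd q \<in> T0 \<and> phi S a = proj S q"
    using phi_proj_ex by (metis fst_conv snd_conv)
  then obtain f where f: "\<And>a. a \<in> T0 \<Longrightarrow> fst (f a) \<in> TY \<and> snd (f a) \<in> T0 \<and> phi S a = proj S (f a)"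
    by metis
  \<comment> \<open>\<open>f\<close> chooses for each point an entry and a successor;
    \<open>c k\<close> follows the successors for \<open>k\<close> steps, and \<open>u a\<close>
    records the entries met along the orbit of \<open>a\<close>.\<close>
  define c where "c k = ((snd \<circ> f) ^^ k)" for k
  define u where "u a = (\<lambda>k. fst (f (c k a)))" for a
  have c: "c k a \<in> T0" if "a \<in> T0" for k a
    unfolding c_def using that by (induction k) (auto simp: f)
  have u: "u a \<in> TN" if "a \<in> T0" for a using f c that by (auto simp: TN_iff u_def)
  have u_tail: "u a \<circ> Suc = u (snd (f a))" for a
    by (auto simp: u_def c_def fun_eq_iff funpow_swap1)
  have "iota p a \<in> cell S p (u a)" if "a \<in> T0" for p a
    using that
  proof (induction p arbitrary: a)
    case 0
    then show ?case by (simp add: cell_0 T_0)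
  next
    case (Suc p)
    have "phi S a = proj S (u a 0, snd (f a))" using f Suc by (simp add: u_def c_def)
    moreover have "iota p (snd (f a)) \<in> cell S p (u a \<circ> Suc)"
      unfolding u_tail using Suc f by blast
    ultimately show ?case using iota_Suc_in_cell[OF u] Suc f by blast
  qed
  then show ?thesis using assms u Gam_iota by blast
qed

section \<open>Closedness of the cell conditions and a compactness argument\<close>

lemma compact_X0: "compact_space (X0 S)" and compact_YY: "compact_space (YY S)"
  and Hausdorff_X1: "Hausdorff_space (X1 S)" and Hausdorff_YY: "Hausdorff_space (YY S)"
  and cont_phi: "continuous_map (X0 S) (X1 S) (phi S)"
  and cont_proj: "continuous_map (prod_topology (YY S) (X0 S)) (X1 S) (proj S)"
  using scheme by (auto simp: similarity_scheme_def)

lemma compact_YN: "compact_space (YN S)"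
  using compact_YY by (simp add: YN_def compact_space_product_topology)

lemma Hausdorff_YN: "Hausdorff_space (YN S)"
  using Hausdorff_YY by (simp add: YN_def Hausdorff_space_product_topology)

lemma cont_nth: "continuous_map (YN S) (YY S) (\<lambda>u. u k)"
  unfolding YN_def by (rule continuous_map_product_projection) simp

lemma cont_tail: "continuous_map (YN S) (YN S) (\<lambda>u. u \<circ> Suc)"
  unfolding YN_def continuous_map_componentwise_UNIV
  by (simp add: cont_nth[unfolded YN_def])

lemma cont_cons: "continuous_map (prod_topology (YY S) (YN S)) (YN S) (\<lambda>(y, u). cons y u)"
  unfolding YN_def continuous_map_componentwise_UNIV
proof
  fix k
  show "continuous_map (prod_topology (YY S) (product_topology (\<lambda>_. YY S) UNIV)) (YY S)
      (\<lambda>x. (case x of (y, u) \<Rightarrow> cons y u) k)"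
  proof (cases k)
    case 0
    then show ?thesis by (simp add: case_prod_unfold continuous_map_fst)
  next
    case (Suc m)
    then show ?thesis
      using continuous_map_compose[OF continuous_map_snd cont_nth[unfolded YN_def, of m]]
      by (simp add: case_prod_unfold cons_def comp_def)
  qed
qed

text \<open>By \<open>iota_Suc_in_cell\<close>, the set for \<open>Suc p\<close> is the projection
  along the compact \<open>X\<^sub>0\<close> of a set cut out by an equation in the Hausdorff space
  \<open>X\<^sub>1\<close> and a preimage of the set for \<open>p\<close>.\<close>

lemma closedin_iota_cell:
  "closedin (prod_topology (X0 S) (YN S))
    {z \<in> topspace (prod_topology (X0 S) (YN S)). iota p (fst z) \<in> cell S p (snd z)}"
proof (induction p)
  case 0
  have "{z \<in> topspace (prod_topology (X0 S) (YN S)). iota 0 (fst z) \<in> cell S 0 (snd z)} =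
      topspace (prod_topology (X0 S) (YN S))"
    by (auto simp: cell_0 T_0)
  then show ?case by (metis closedin_topspace)
next
  case (Suc p)
  let ?A = "prod_topology (X0 S) (YN S)"
  let ?B = "prod_topology ?A (X0 S)"
  have c1: "continuous_map ?B (X0 S) (\<lambda>w. fst (fst w))"
    and c2: "continuous_map ?B (YN S) (\<lambda>w. snd (fst w))"
    and c3: "continuous_map ?B (X0 S) snd"
    using continuous_map_compose[OF continuous_map_fst continuous_map_fst]
      continuous_map_compose[OF continuous_map_fst continuous_map_snd]
    by (auto simp: comp_def continuous_map_snd)
  have c4: "continuous_map ?B (X1 S) (\<lambda>w. phi S (fst (fst w)))"
    using continuous_map_compose[OF c1 cont_phi] by (simp add: comp_def)
  have c5: "continuous_map ?B (X1 S) (\<lambda>w. proj S (snd (fst w) 0, snd w))"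
    using continuous_map_compose[OF continuous_map_pairedI[OF
        continuous_map_compose[OF c2 cont_nth[of 0]] c3] cont_proj]
    by (simp add: comp_def)
  have c6: "continuous_map ?B ?A (\<lambda>w. (snd w, snd (fst w) \<circ> Suc))"
    using continuous_map_pairedI[OF c3 continuous_map_compose[OF c2 cont_tail]]
    by (simp add: comp_def)
  have "closedin ?B {w \<in> topspace ?B. (snd w, snd (fst w) \<circ> Suc) \<in>
      {z \<in> topspace ?A. iota p (fst z) \<in> cell S p (snd z)}}"
    using closedin_continuous_map_preimage[OF c6 Suc] .
  also have "{w \<in> topspace ?B. (snd w, snd (fst w) \<circ> Suc) \<in>
      {z \<in> topspace ?A. iota p (fst z) \<in> cell S p (snd z)}} =
      {w \<in> topspace ?B. iota p (snd w) \<in> cell S p (snd (fst w) \<circ> Suc)}"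
    using tail_in by auto
  finally have "closedin ?B {w \<in> topspace ?B. phi S (fst (fst w)) = proj S (snd (fst w) 0, snd w) \<and>
      iota p (snd w) \<in> cell S p (snd (fst w) \<circ> Suc)}"
    by (rule closedin_conj[OF closedin_continuous_maps_eq[OF Hausdorff_X1 c4 c5]])
  then have "closedin ?A {z \<in> topspace ?A. \<exists>b\<in>T0. phi S (fst z) = proj S (snd z 0, b) \<and>
      iota p b \<in> cell S p (snd z \<circ> Suc)}"
    by (rule closedin_Bex_compact[OF compact_X0])
  also have "{z \<in> topspace ?A. \<exists>b\<in>T0. phi S (fst z) = proj S (snd z 0, b) \<and>
      iota p b \<in> cell S p (snd z \<circ> Suc)} =
      {z \<in> topspace ?A. iota (Suc p) (fst z) \<in> cell S (Suc p) (snd z)}"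
    using iota_Suc_in_cell by auto
  finally show ?case .
qed

lemma closedin_Gam_0:
  "closedin (prod_topology (X0 S) (YN S))
    {z \<in> topspace (prod_topology (X0 S) (YN S)). snd z \<in> Gam S 0 (Pt0 (fst z))}"
proof -
  have "{z \<in> topspace (prod_topology (X0 S) (YN S)). snd z \<in> Gam S 0 (Pt0 (fst z))} =
      (\<Inter>p. {z \<in> topspace (prod_topology (X0 S) (YN S)). iota p (fst z) \<in> cell S p (snd z)})"
    using Gam_iota by auto
  then show ?thesis using closedin_iota_cell by (auto intro!: closedin_Inter)
qed

text \<open>Each level supplies its own second coordinate with first entry \<open>u 0\<close>; the
  difficulty is to find one that works at all levels. Off the image of \<open>X\<^sub>0\<close> it
  is unique, and on that image compactness of \<open>X\<^sub>0\<close> provides a common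
  choice.\<close>

lemma Gam_Suc_D:
  assumes x: "x \<in> T (Suc n)" and u: "u \<in> Gam S (Suc n) x"
  shows "\<exists>z\<in>T n. x = pi1 S n (u 0, z) \<and> u \<circ> Suc \<in> Gam S n z"
proof -
  have uN: "u \<in> TN" and uc: "\<And>k. phi_from S (Suc n) k x \<in> cell S (Suc n + k) u"
    using u by (auto simp: Gam_iff)
  have u0: "u 0 \<in> TY" and tN: "u \<circ> Suc \<in> TN" using uN tail_in by (auto simp: TN_iff)
  obtain z where z: "z \<in> cell S n (u \<circ> Suc)" "x = pi1 S n (u 0, z)"
    using uc[of 0] by (auto simp: cell_Suc)
  have zT: "z \<in> T n" using z cell_subset tN by blast
  have alt: "phi_from S n k z \<in> cell S (n + k) (u \<circ> Suc) \<or>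
      (\<exists>a\<in>T0. \<exists>b\<in>T0. phi_from S n k z = iota (n + k) a \<and> proj S (u 0, a) = proj S (u 0, b) \<and>
         iota (n + k) b \<in> cell S (n + k) (u \<circ> Suc))" for k
    using uc[of k] pi1_in_cell_Suc[OF uN u0 phi_from_in[OF zT, of k]]
    by (simp add: z(2) phi_from_pi1 u0 zT)
  show ?thesis
  proof (cases "z \<in> iota n ` T0")
    case False
    \<comment> \<open>The images of \<open>z\<close> at higher levels also avoid
      \<open>X\<^sub>0\<close>, so the first alternative of \<open>alt\<close> always holds.\<close>
    then have "phi_from S n k z \<in> cell S (n + k) (u \<circ> Suc)" for k
      using alt[of k] iota_of_phi_from[OF zT] by blast
    then show ?thesis using tN zT z by (auto simp: Gam_iff)
  next
    case True
    then obtain a where a: "a \<in> T0" "z = iota n a" by auto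
    \<comment> \<open>\<open>A p\<close> collects the points in the fibre of \<open>a\<close> that
      are admissible at level \<open>p\<close>. These sets are closed, nonempty and decreasing, and
      a common point is the required choice.\<close>
    define A where "A p = {b \<in> T0. proj S (u 0, b) = proj S (u 0, a) \<and>
      iota p b \<in> cell S p (u \<circ> Suc)}" for p
    have dec: "A (Suc p) \<subseteq> A p" for p
      using cell_of_phi_step[OF tN iota_in] phi_step_iota by (auto simp: A_def)
    have dec': "A q \<subseteq> A p" if "p \<le> q" for p q
      using lift_Suc_antimono_le[of A, OF dec that] .
    have ne: "A p \<noteq> {}" for p
    proof -
      \<comment> \<open>In the first alternative of \<open>alt\<close>, \<open>a\<close> itself is a
        witness. Only levels from \<open>n\<close> on are reached this way; monotonicity handles the
        rest.\<close>
      have "\<exists>b\<in>T0. proj S (u 0, b) = proj S (u 0, a) \<and> iota (n + p) b \<in> cell S (n + p) (u \<circ> Suc)"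
        using alt[of p] phi_from_iota[of a n p] iota_eq_iff a by metis
      then have "A (n + p) \<noteq> {}" by (auto simp: A_def)
      then show ?thesis using dec'[of p "n + p"] by auto
    qed
    have cl: "closedin (X0 S) (A p)" for p
      unfolding A_def
    proof (rule closedin_conj)
      have ca: "proj S (u 0, a) \<in> topspace (X1 S)"
        using continuous_map_image_subset_topspace[OF cont_proj] u0 a by auto
      have "continuous_map (X0 S) (X1 S) (\<lambda>b. proj S (u 0, b))"
        using continuous_map_compose[OF _ cont_proj, of "X0 S" "\<lambda>b. (u 0, b)"] u0
        by (simp add: comp_def continuous_map_pairwise)
      then show "closedin (X0 S) {b \<in> T0. proj S (u 0, b) = proj S (u 0, a)}"
        using ca by (intro closedin_continuous_maps_eq[OF Hausdorff_X1]) auto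
      have "continuous_map (X0 S) (prod_topology (X0 S) (YN S)) (\<lambda>b. (b, u \<circ> Suc))"
        using tN by (simp add: comp_def continuous_map_pairwise)
      from closedin_continuous_map_preimage[OF this closedin_iota_cell[of p]]
      show "closedin (X0 S) {b \<in> T0. iota p b \<in> cell S p (u \<circ> Suc)}"
        using tN by (simp cong: conj_cong)
    qed
    have "(\<Inter>p. A p) \<noteq> {}"
      using compact_space_imp_nest[OF compact_X0 cl ne] dec' by (simp add: decseq_def)
    then obtain b where b: "\<And>p. b \<in> A p" by auto
    then have b0: "b \<in> T0" and bp: "proj S (u 0, b) = proj S (u 0, a)" by (auto simp: A_def)
    have "u \<circ> Suc \<in> Gam S 0 (Pt0 b)" using b Gam_iota[OF b0] tN by (auto simp: A_def)
    moreover have "x = pi1 S n (u 0, iota n b)"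
      using pi1_eq_iff[OF u0 u0 zT iota_in[OF b0]] b0 bp a z by metis
    ultimately show ?thesis using Gam_iota_n[OF b0] iota_in[OF b0] by blast
  qed
qed

section \<open>The relations on sequences and the limit space\<close>

lemma R_rel_refl: "u \<in> TN \<Longrightarrow> (u, u) \<in> R_rel S"
  by (simp add: R_rel_def)

lemma R_rel_I: "x \<in> T n \<Longrightarrow> u \<in> Gam S n x \<Longrightarrow> v \<in> Gam S n x \<Longrightarrow> (u, v) \<in> R_rel S"
  by (auto simp: R_rel_def Gam_iff)

lemma Gam_in_TN: "u \<in> Gam S n x \<Longrightarrow> u \<in> TN"
  by (simp add: Gam_iff)

lemma R_rel_subset: "R_rel S \<subseteq> R_inf S"
  by (auto simp: R_inf_def)

lemma equiv_R_inf: "equiv TN (R_inf S)"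
proof (rule equivI)
  \<comment> \<open>The full relation belongs to the family intersected in \<open>R_inf\<close>, so
    the intersection stays inside \<open>TN \<times> TN\<close>.\<close>
  have "equiv TN (TN \<times> TN)"
    by (rule equivI) (auto simp: refl_on_def sym_def trans_def)
  moreover have "R_rel S \<subseteq> TN \<times> TN" by (auto simp: R_rel_def)
  ultimately show "R_inf S \<subseteq> TN \<times> TN" by (auto simp: R_inf_def)
  show "refl_on TN (R_inf S)" using R_rel_subset R_rel_refl by (auto simp: refl_on_def)
  show "sym (R_inf S)"
    by (rule symI) (auto simp: R_inf_def dest: equiv_type elim: equivE intro: symD)
  show "trans (R_inf S)"
    by (rule transI) (unfold R_inf_def, blast elim: equivE dest: transD)
qed

lemma piN_eq_iff: "u \<in> TN \<Longrightarrow> v \<in> TN \<Longrightarrow> piN S u = piN S v \<longleftrightarrow> (u, v) \<in> R_inf S"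
  unfolding piN_def by (rule eq_equiv_class_iff[OF equiv_R_inf])

text \<open>All of \<open>Gam S n x\<close> lies in a single class, so \<open>the_elem\<close> is
  applied to a singleton.\<close>

lemma phi_inf_eq:
  assumes "x \<in> T n" "u \<in> Gam S n x"
  shows "phi_inf S n x = piN S u"
proof -
  have "piN S v = piN S u" if "v \<in> Gam S n x" for v
    unfolding piN_eq_iff[OF Gam_in_TN[OF that] Gam_in_TN[OF assms(2)]]
    using R_rel_I[OF assms(1) that assms(2)] R_rel_subset by blast
  then have "piN S ` Gam S n x = {piN S u}" using assms(2) by blast
  then show ?thesis by (simp add: phi_inf_def)
qed

lemma phi_inf0_eq: "a \<in> T0 \<Longrightarrow> u \<in> Gam S 0 (Pt0 a) \<Longrightarrow> phi_inf0 S a = piN S u"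
  using phi_inf_eq[of "Pt0 a" 0 u] by (simp add: phi_inf0_def T_0)

lemma quotient_map_piN: "quotient_map (YN S) (X_inf S) (piN S)"
  unfolding X_inf_def by (rule quotient_map_quot_top)

lemma topspace_X_inf: "topspace (X_inf S) = piN S ` TN"
  by (simp add: X_inf_def topspace_quot_top)

lemma compact_X_inf: "compact_space (X_inf S)"
  using compact_YN quotient_map_piN compact_space_quotient_map_image by blast

text \<open>The preimage of a closed \<open>F\<close> is the projection, along the compact sequence
  space, of the closed set of pairs \<open>(a, u)\<close> with \<open>u\<close> in
  \<open>\<Gamma>\<^sub>0(a)\<close> and \<open>piN S u\<close> in \<open>F\<close>.\<close>

lemma cont_phi_inf0: "continuous_map (X0 S) (X_inf S) (phi_inf0 S)"
  unfolding continuous_map_closedin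
proof (intro conjI allI impI)
  show "phi_inf0 S \<in> T0 \<rightarrow> topspace (X_inf S)"
  proof
    fix a assume a: "a \<in> T0"
    then obtain u where "u \<in> Gam S 0 (Pt0 a)" using Gam_0_ex by blast
    then show "phi_inf0 S a \<in> topspace (X_inf S)"
      using phi_inf0_eq[OF a] by (auto simp: topspace_X_inf Gam_iff)
  qed
next
  fix F assume F: "closedin (X_inf S) F"
  let ?A = "prod_topology (X0 S) (YN S)"
  have "continuous_map ?A (X_inf S) (\<lambda>z. piN S (snd z))"
    using continuous_map_compose[OF continuous_map_snd quotient_imp_continuous_map[OF quotient_map_piN]]
    by (simp add: comp_def)
  from closedin_conj[OF closedin_Gam_0 closedin_continuous_map_preimage[OF this F]]
  have "closedin ?A {z \<in> topspace ?A. snd z \<in> Gam S 0 (Pt0 (fst z)) \<and> piN S (snd z) \<in> F}" .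
  then have "closedin (X0 S) {a \<in> T0. \<exists>u\<in>TN. u \<in> Gam S 0 (Pt0 a) \<and> piN S u \<in> F}"
    by (rule closedin_Bex_compact[OF compact_YN])
  also have "{a \<in> T0. \<exists>u\<in>TN. u \<in> Gam S 0 (Pt0 a) \<and> piN S u \<in> F} = {a \<in> T0. phi_inf0 S a \<in> F}"
  proof -
    have "(\<exists>u\<in>TN. u \<in> Gam S 0 (Pt0 a) \<and> piN S u \<in> F) \<longleftrightarrow> phi_inf0 S a \<in> F" if a: "a \<in> T0" for a
      using phi_inf0_eq[OF a] Gam_0_ex[OF a] by (auto simp: Gam_iff)
    then show ?thesis by blast
  qed
  finally show "closedin (X0 S) {a \<in> T0. phi_inf0 S a \<in> F}" .
qed

text \<open>Clause (ii) in the definition of \<open>R_hat\<close>.\<close>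

definition base_rel :: "((nat \<Rightarrow> 'y) \<times> (nat \<Rightarrow> 'y)) set" where
  "base_rel = {(u, v) \<in> TN \<times> TN. \<exists>a\<in>T0. \<exists>b\<in>T0. proj S (u 0, a) = proj S (v 0, b) \<and>
     u \<circ> Suc \<in> Gam S 0 (Pt0 a) \<and> v \<circ> Suc \<in> Gam S 0 (Pt0 b)}"

lemma R_hat_iff:
  "(u, v) \<in> R_hat S \<longleftrightarrow> u \<in> TN \<and> v \<in> TN \<and>
     (u 0 = v 0 \<and> (u \<circ> Suc, v \<circ> Suc) \<in> R_rel S \<or> (u, v) \<in> base_rel)"
  unfolding R_hat_def base_rel_def R_rel_def using tail_in by auto

lemma closedin_base_rel: "closedin (prod_topology (YN S) (YN S)) base_rel"
proof -
  let ?V = "prod_topology (YN S) (YN S)"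
  let ?A = "prod_topology ?V (X0 S)"
  let ?B = "prod_topology ?A (X0 S)"
  have c1: "continuous_map ?B (YN S) (\<lambda>w. fst (fst (fst w)))"
    and c2: "continuous_map ?B (YN S) (\<lambda>w. snd (fst (fst w)))"
    and c3: "continuous_map ?B (X0 S) (\<lambda>w. snd (fst w))"
    and c4: "continuous_map ?B (X0 S) snd"
    using continuous_map_compose[OF continuous_map_fst continuous_map_compose[OF continuous_map_fst continuous_map_fst]]
      continuous_map_compose[OF continuous_map_fst continuous_map_compose[OF continuous_map_fst continuous_map_snd]]
      continuous_map_compose[OF continuous_map_fst continuous_map_snd]
    by (auto simp: comp_def continuous_map_snd)
  have p: "closedin ?B {w \<in> topspace ?B.
      proj S (fst (fst (fst w)) 0, snd (fst w)) = proj S (snd (fst (fst w)) 0, snd w)}"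
    using continuous_map_compose[OF continuous_map_pairedI[OF
        continuous_map_compose[OF c1 cont_nth[of 0]] c3] cont_proj]
      continuous_map_compose[OF continuous_map_pairedI[OF
        continuous_map_compose[OF c2 cont_nth[of 0]] c4] cont_proj]
    by (intro closedin_continuous_maps_eq[OF Hausdorff_X1]) (auto simp: comp_def)
  have G: "closedin ?B {w \<in> topspace ?B. f w \<circ> Suc \<in> Gam S 0 (Pt0 (g w))}"
    if f: "continuous_map ?B (YN S) f" and g: "continuous_map ?B (X0 S) g" for f g
  proof -
    have "continuous_map ?B (prod_topology (X0 S) (YN S)) (\<lambda>w. (g w, f w \<circ> Suc))"
      using continuous_map_pairedI[OF g continuous_map_compose[OF f cont_tail]]
      by (simp add: comp_def)
    from closedin_continuous_map_preimage[OF this closedin_Gam_0]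
    have "closedin ?B {w \<in> topspace ?B. (g w, f w \<circ> Suc) \<in>
      {z \<in> topspace (prod_topology (X0 S) (YN S)). snd z \<in> Gam S 0 (Pt0 (fst z))}}" .
    also have "{w \<in> topspace ?B. (g w, f w \<circ> Suc) \<in>
      {z \<in> topspace (prod_topology (X0 S) (YN S)). snd z \<in> Gam S 0 (Pt0 (fst z))}} =
      {w \<in> topspace ?B. f w \<circ> Suc \<in> Gam S 0 (Pt0 (g w))}"
      using continuous_map_image_subset_topspace[OF f] continuous_map_image_subset_topspace[OF g]
        tail_in by (auto simp: image_subset_iff)
    finally show ?thesis .
  qed
  have "closedin ?V {z \<in> topspace ?V. \<exists>a\<in>T0. \<exists>b\<in>T0. proj S (fst z 0, a) = proj S (snd z 0, b) \<and>
     fst z \<circ> Suc \<in> Gam S 0 (Pt0 a) \<and> snd z \<circ> Suc \<in> Gam S 0 (Pt0 b)}"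
    by (intro closedin_Bex_compact[OF compact_X0] closedin_conj p G c1 c2 c3 c4)
  also have "{z \<in> topspace ?V. \<exists>a\<in>T0. \<exists>b\<in>T0. proj S (fst z 0, a) = proj S (snd z 0, b) \<and>
     fst z \<circ> Suc \<in> Gam S 0 (Pt0 a) \<and> snd z \<circ> Suc \<in> Gam S 0 (Pt0 b)} = base_rel"
    by (simp add: base_rel_def case_prod_unfold mem_Times_iff)
  finally show ?thesis .
qed

end

section \<open>Consequences of full injectivity\<close>

locale inj_scheme = sim_scheme +
  assumes full: "fully_injective S"
begin

lemma Gam_inj:
  assumes "x \<in> T n" "x' \<in> T n" "u \<in> Gam S n x" "v \<in> Gam S n x'" "(u, v) \<in> R_inf S"
  shows "x = x'"
proof -
  have "phi_inf S n x = phi_inf S n x'"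
    unfolding phi_inf_eq[OF assms(1,3)] phi_inf_eq[OF assms(2,4)]
      piN_eq_iff[OF Gam_in_TN[OF assms(3)] Gam_in_TN[OF assms(4)]] by (rule assms(5))
  moreover have "inj_on (phi_inf S n) (T n)" using full by (simp add: fully_injective_def)
  ultimately show ?thesis using assms(1,2) by (auto dest: inj_onD)
qed

text \<open>Push both points up to level \<open>n + m\<close>, which leaves their \<open>Gam\<close>
  sets unchanged. There both sets contain \<open>u\<close>, so \<open>Gam_inj\<close> identifies the
  points.\<close>

lemma Gam_eq:
  assumes "x \<in> T n" "x' \<in> T m" "u \<in> Gam S n x" "u \<in> Gam S m x'"
  shows "Gam S n x = Gam S m x'"
proof -
  have 1: "Gam S (n + m) (phi_from S n m x) = Gam S n x" using Gam_phi_from assms by blast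
  have 2: "Gam S (n + m) (phi_from S m n x') = Gam S m x'"
    using Gam_phi_from[of x' m n] assms by (simp add: add.commute[of m n])
  have "(u, u) \<in> R_inf S" using Gam_in_TN[OF assms(3)] R_rel_subset R_rel_refl by blast
  then have "phi_from S n m x = phi_from S m n x'"
    using Gam_inj[of "phi_from S n m x" "n + m" "phi_from S m n x'" u u] 1 2 assms
      phi_from_in[of x n m] phi_from_in[of x' m n] by (simp add: add.commute[of m n])
  then show ?thesis using 1 2 by simp
qed

text \<open>Any other \<open>Gam\<close> set containing \<open>u\<close> and \<open>v\<close> meets
  this one in \<open>u\<close>, hence equals it. Transitivity of \<open>R_rel S\<close>
  follows.\<close>

lemma Gam_saturated:
  assumes "x \<in> T n" "u \<in> Gam S n x" "(u, v) \<in> R_rel S"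
  shows "v \<in> Gam S n x"
proof (cases "u = v")
  case False
  then obtain m x' where "x' \<in> T m" "u \<in> Gam S m x'" "v \<in> Gam S m x'"
    using assms(3) by (auto simp: R_rel_def)
  then show ?thesis using Gam_eq[OF assms(1) _ assms(2)] by blast
qed (use assms in simp)

lemma R_inf_eq: "R_inf S = R_rel S"
proof
  have "sym (R_rel S)" by (auto simp: R_rel_def sym_def)
  moreover have "trans (R_rel S)"
  proof (rule transI)
    fix u v w assume uv: "(u, v) \<in> R_rel S" and vw: "(v, w) \<in> R_rel S"
    show "(u, w) \<in> R_rel S"
    proof (cases "u = v")
      case False
      then obtain n x where x: "x \<in> T n" "u \<in> Gam S n x" "v \<in> Gam S n x"
        using uv by (auto simp: R_rel_def)
      show ?thesis using R_rel_I[OF x(1,2) Gam_saturated[OF x(1,3) vw]] .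
    qed (use vw in simp)
  qed
  ultimately have "equiv TN (R_rel S)"
    by (intro equivI) (auto simp: R_rel_refl refl_on_def, auto simp: R_rel_def)
  then show "R_inf S \<subseteq> R_rel S" by (auto simp: R_inf_def)
qed (rule R_rel_subset)

lemma R_rel_eq_R_hat: "R_rel S = R_hat S"
proof -
  have "(u, v) \<in> R_rel S \<longleftrightarrow> (u, v) \<in> R_hat S" for u v
  proof
    assume uv: "(u, v) \<in> R_rel S"
    then have N: "u \<in> TN" "v \<in> TN" by (auto simp: R_rel_def)
    then have 0: "u 0 \<in> TY" "v 0 \<in> TY" by (auto simp: TN_iff)
    show "(u, v) \<in> R_hat S"
    proof (cases "u = v")
      case True
      then show ?thesis using N tail_in R_rel_refl by (auto simp: R_hat_iff)
    next
      case False
      then obtain n x where x: "x \<in> T n" "u \<in> Gam S n x" "v \<in> Gam S n x"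
        using uv by (auto simp: R_rel_def)
      \<comment> \<open>Moving up one level makes \<open>Gam_Suc_D\<close> applicable even when
        \<open>n = 0\<close>.\<close>
      then have x': "phi_step S n x \<in> T (Suc n)" "u \<in> Gam S (Suc n) (phi_step S n x)"
        "v \<in> Gam S (Suc n) (phi_step S n x)"
        using phi_step_in Gam_phi_step by auto
      obtain z where z: "z \<in> T n" "phi_step S n x = pi1 S n (u 0, z)" "u \<circ> Suc \<in> Gam S n z"
        using Gam_Suc_D x' by blast
      obtain z' where z': "z' \<in> T n" "phi_step S n x = pi1 S n (v 0, z')" "v \<circ> Suc \<in> Gam S n z'"
        using Gam_Suc_D x' by blast
      have "(u 0, z) = (v 0, z') \<or>
        (\<exists>a\<in>T0. \<exists>b\<in>T0. z = iota n a \<and> z' = iota n b \<and> proj S (u 0, a) = proj S (v 0, b))"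
        using pi1_eq_iff[OF 0 z(1) z'(1)] z z' by simp
      then show ?thesis
      proof (elim disjE bexE conjE)
        assume "(u 0, z) = (v 0, z')"
        then show ?thesis using N z z' R_rel_I by (auto simp: R_hat_iff)
      next
        fix a b assume "a \<in> T0" "b \<in> T0" "z = iota n a" "z' = iota n b"
          "proj S (u 0, a) = proj S (v 0, b)"
        then have "(u, v) \<in> base_rel" using N z z' Gam_iota_n unfolding base_rel_def by blast
        then show ?thesis using N by (simp add: R_hat_iff)
      qed
    qed
  next
    assume uv: "(u, v) \<in> R_hat S"
    then have N: "u \<in> TN" "v \<in> TN" by (auto simp: R_hat_iff)
    then have 0: "u 0 \<in> TY" "v 0 \<in> TY" by (auto simp: TN_iff)
    consider "u 0 = v 0" "(u \<circ> Suc, v \<circ> Suc) \<in> R_rel S" | "(u, v) \<in> base_rel"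
      using uv by (auto simp: R_hat_iff)
    then show "(u, v) \<in> R_rel S"
    proof cases
      case 1
      show ?thesis
      proof (cases "u \<circ> Suc = v \<circ> Suc")
        case True
        then have "u = v" using 1 cons_simps(3) by metis
        then show ?thesis using N R_rel_refl by simp
      next
        case False
        then obtain n x where x: "x \<in> T n" "u \<circ> Suc \<in> Gam S n x" "v \<circ> Suc \<in> Gam S n x"
          using 1 by (auto simp: R_rel_def)
        then show ?thesis
          using Gam_pi1_I[OF N(1) x(1,2)] Gam_pi1_I[OF N(2) x(1,3)] 1 R_rel_I pi1_in[OF 0(1) x(1)]
          by simp
      qed
    next
      case 2
      then obtain a b where ab: "a \<in> T0" "b \<in> T0" "proj S (u 0, a) = proj S (v 0, b)"
        "u \<circ> Suc \<in> Gam S 0 (Pt0 a)" "v \<circ> Suc \<in> Gam S 0 (Pt0 b)"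
        unfolding base_rel_def by auto
      \<comment> \<open>The two sequences share the point
        \<open>pi1 S 0 (u 0, Pt0 a) = pi1 S 0 (v 0, Pt0 b)\<close> of
        \<open>X\<^sub>1\<close>.\<close>
      have P: "Pt0 a \<in> T 0" "Pt0 b \<in> T 0" using ab T_0 by auto
      show ?thesis
        using Gam_pi1_I[OF N(1) P(1) ab(4)] Gam_pi1_I[OF N(2) P(2) ab(5)] ab(3)
          R_rel_I pi1_in[OF 0(1) P(1)] by simp
    qed
  qed
  then show ?thesis by auto
qed

section \<open>Closedness of the relation and the Hausdorff property of the limit space\<close>

lemma closedin_R_inf: "closedin (prod_topology (YN S) (YN S)) (R_inf S)"
proof -
  let ?V = "prod_topology (YN S) (YN S)"
  let ?C = "?V closure_of R_rel S"
  \<comment> \<open>Clause (i) of \<open>R_hat\<close> with the relation replaced by its closure,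
    which turns it into a closed condition.\<close>
  let ?D = "{z \<in> topspace ?V. fst z 0 = snd z 0 \<and> (fst z \<circ> Suc, snd z \<circ> Suc) \<in> ?C}"
  have sub: "R_rel S \<subseteq> topspace ?V" by (auto simp: R_rel_def)
  have c: "continuous_map ?V (YY S) (\<lambda>z. fst z 0)" "continuous_map ?V (YY S) (\<lambda>z. snd z 0)"
    "continuous_map ?V ?V (\<lambda>z. (fst z \<circ> Suc, snd z \<circ> Suc))"
    using continuous_map_compose[OF continuous_map_fst cont_nth[of 0]]
      continuous_map_compose[OF continuous_map_snd cont_nth[of 0]]
      continuous_map_pairedI[OF continuous_map_compose[OF continuous_map_fst cont_tail]
        continuous_map_compose[OF continuous_map_snd cont_tail]]
    by (auto simp: comp_def)
  have D: "closedin ?V ?D"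
    using closedin_continuous_maps_eq[OF Hausdorff_YY c(1,2)]
      closedin_continuous_map_preimage[OF c(3) closedin_closure_of]
    by (rule closedin_conj)
  have "R_hat S \<subseteq> base_rel \<union> ?D"
  proof
    fix z assume "z \<in> R_hat S"
    moreover obtain u v where z: "z = (u, v)" by (metis surj_pair)
    ultimately have "u \<in> TN" "v \<in> TN"
      "u 0 = v 0 \<and> (u \<circ> Suc, v \<circ> Suc) \<in> R_rel S \<or> (u, v) \<in> base_rel"
      by (auto simp: R_hat_iff)
    then show "z \<in> base_rel \<union> ?D" unfolding z using closure_of_subset[OF sub] by auto
  qed
  then have "R_rel S \<subseteq> base_rel \<union> ?D" by (simp only: R_rel_eq_R_hat)
  then have CKD: "?C \<subseteq> base_rel \<union> ?D"
    using closedin_base_rel D by (intro closure_of_minimal) auto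
  \<comment> \<open>A pair outside \<open>R_hat S\<close> is outside \<open>base_rel\<close>, so it
    lies in \<open>?D\<close>; its tails are not related, since otherwise clause (i) would
    apply.\<close>
  have step: "u 0 = v 0 \<and> (u \<circ> Suc, v \<circ> Suc) \<in> ?C - R_rel S" if uv: "(u, v) \<in> ?C - R_rel S" for u v
  proof -
    have N: "u \<in> TN" "v \<in> TN" using uv closure_of_subset_topspace[of ?V "R_rel S"] by auto
    have "(u, v) \<notin> R_hat S" using uv R_rel_eq_R_hat by auto
    then show ?thesis using N uv CKD by (auto simp: R_hat_iff)
  qed
  txt \<open>Iterating \<open>step\<close>, a pair in the closure but outside the relation would agree in every entry.\<close>
  have "?C \<subseteq> R_rel S"
  proof (rule ccontr)
    assume "\<not> ?C \<subseteq> R_rel S"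
    then obtain u v where uv: "(u, v) \<in> ?C - R_rel S" by auto
    have "u k = v k" if "(u, v) \<in> ?C - R_rel S" for k u v
      using that
    proof (induction k arbitrary: u v)
      case (Suc k)
      then show ?case using Suc.IH[OF conjunct2[OF step[OF Suc.prems]]] by simp
    qed (use step in blast)
    then have "u = v" using uv by blast
    moreover have "u \<in> TN" using uv closure_of_subset_topspace[of ?V "R_rel S"] by auto
    ultimately show False using uv R_rel_refl by auto
  qed
  then have "?C = R_rel S" using closure_of_subset[OF sub] by blast
  then show ?thesis unfolding R_inf_eq by (metis closedin_closure_of)
qed

lemma Hausdorff_X_inf: "Hausdorff_space (X_inf S)"
  using Hausdorff_space_quot_top_closed_equiv[OF compact_YN Hausdorff_YN equiv_R_inf closedin_R_inf]
  by (simp add: X_inf_def piN_def[abs_def])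

section \<open>The isomorphism with the limit space\<close>

lemma piN_eq_phi_inf0:
  assumes "a \<in> T0" "u \<in> TN"
  shows "piN S u = phi_inf0 S a \<longleftrightarrow> u \<in> Gam S 0 (Pt0 a)"
proof
  assume eq: "piN S u = phi_inf0 S a"
  obtain v where v: "v \<in> Gam S 0 (Pt0 a)" using Gam_0_ex assms by blast
  then have "(v, u) \<in> R_rel S"
    using eq phi_inf0_eq[OF assms(1) v] piN_eq_iff[OF Gam_in_TN[OF v] assms(2)] R_inf_eq by simp
  then show "u \<in> Gam S 0 (Pt0 a)" using Gam_saturated v assms T_0 by blast
qed (use phi_inf0_eq[OF assms(1), of u] in simp)

lemma inj_phi_inf0: "inj_on (phi_inf0 S) T0"
proof -
  have "inj_on (phi_inf S 0) (Pt0 ` T0)" using full T_0 unfolding fully_injective_def by metis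
  then show ?thesis unfolding phi_inf0_def by (intro comp_inj_on) (auto intro: inj_onI)
qed

lemma scheme_pair_X_inf: "scheme_pair S (X_inf S, phi_inf0 S)"
  by (simp add: scheme_pair_def compact_X_inf Hausdorff_X_inf cont_phi_inf0 inj_phi_inf0)

text \<open>This is \<open>R_inf S = R_hat S\<close> read through prepending: clause (i) becomes
  equality in \<open>Y \<times> X\<^sub>\<infinity>\<close>, and clause (ii) becomes gluing along
  \<open>X\<^sub>0\<close>, because \<open>\<Gamma>\<^sub>0(a)\<close> is the whole class
  \<open>phi_inf0 S a\<close>.\<close>

lemma hat_rel_X_inf_iff:
  assumes "y \<in> TY" "y' \<in> TY" "u \<in> TN" "u' \<in> TN"
  shows "((y, piN S u), (y', piN S u')) \<in> hat_rel S (X_inf S, phi_inf0 S) \<longleftrightarrow>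
    (cons y u, cons y' u') \<in> R_inf S"
proof -
  have "(cons y u, cons y' u') \<in> R_inf S \<longleftrightarrow> y = y' \<and> (u, u') \<in> R_inf S \<or> (cons y u, cons y' u') \<in> base_rel"
    unfolding R_inf_eq using assms cons_in R_hat_iff[of "cons y u" "cons y' u'"]
    by (simp add: R_rel_eq_R_hat[symmetric])
  also have "\<dots> \<longleftrightarrow> y = y' \<and> piN S u = piN S u' \<or>
      (\<exists>a\<in>T0. \<exists>b\<in>T0. piN S u = phi_inf0 S a \<and> piN S u' = phi_inf0 S b \<and> proj S (y, a) = proj S (y', b))"
    using assms cons_in piN_eq_iff piN_eq_phi_inf0 by (auto simp: base_rel_def)
  finally show ?thesis using assms by (simp add: hat_rel_def topspace_X_inf)
qed

lemma pair_iso_X_inf: "pair_iso S (Phi S (X_inf S, phi_inf0 S)) (X_inf S, phi_inf0 S)"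
proof -
  let ?P = "(X_inf S, phi_inf0 S)"
  let ?Q = "prod_topology (YY S) (YN S)"
  \<comment> \<open>\<open>?f\<close> and \<open>?h\<close> turn out to have the same fibres. Hence
    \<open>?h\<close> factors through the quotient map \<open>?f\<close> by a continuous bijection
    from a compact to a Hausdorff space.\<close>
  let ?f = "\<lambda>z. hat_proj S ?P (fst z, piN S (snd z))"
  let ?h = "\<lambda>z. piN S (cons (fst z) (snd z))"
  have cpiN: "continuous_map (YN S) (X_inf S) (piN S)"
    by (rule quotient_imp_continuous_map[OF quotient_map_piN])
  have equiv: "equiv (topspace (prod_topology (YY S) (X_inf S))) (hat_rel S ?P)"
    using equiv_hat_rel[of ?P S] inj_phi_inf0 by simp
  \<comment> \<open>A product of quotient maps need not be a quotient map; here it is one, being a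
    continuous surjection from a compact to a Hausdorff space.\<close>
  have "quotient_map ?Q (prod_topology (YY S) (X_inf S)) (\<lambda>z. (fst z, piN S (snd z)))"
  proof (rule continuous_imp_quotient_map)
    show "continuous_map ?Q (prod_topology (YY S) (X_inf S)) (\<lambda>z. (fst z, piN S (snd z)))"
      using continuous_map_pairedI[OF continuous_map_fst continuous_map_compose[OF continuous_map_snd cpiN]]
      by (simp add: comp_def)
    show "compact_space ?Q" using compact_YY compact_YN by (simp add: compact_space_prod_topology)
    show "Hausdorff_space (prod_topology (YY S) (X_inf S))"
      using Hausdorff_YY Hausdorff_X_inf by (simp add: Hausdorff_space_prod_topology)
  qed (force simp: topspace_X_inf image_iff)
  then have qf: "quotient_map ?Q (hat_space S ?P) ?f"
    using quotient_map_compose[OF _ quotient_map_quot_top, of ?Q "prod_topology (YY S) (X_inf S)"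
        "\<lambda>z. (fst z, piN S (snd z))" "hat_proj S ?P"]
    by (simp add: hat_space_def comp_def)
  have ch: "continuous_map ?Q (X_inf S) ?h"
    using continuous_map_compose[OF cont_cons cpiN] by (simp add: comp_def case_prod_unfold)
  have fh: "?f z = ?f z' \<longleftrightarrow> ?h z = ?h z'" if z: "z \<in> topspace ?Q" "z' \<in> topspace ?Q" for z z'
  proof -
    have m: "fst z \<in> TY" "fst z' \<in> TY" "snd z \<in> TN" "snd z' \<in> TN" using z by auto
    have "?f z = ?f z' \<longleftrightarrow> ((fst z, piN S (snd z)), (fst z', piN S (snd z'))) \<in> hat_rel S ?P"
      unfolding hat_proj_def using m
      by (intro eq_equiv_class_iff[OF equiv]) (auto simp: topspace_X_inf)
    then show ?thesis using hat_rel_X_inf_iff[OF m] piN_eq_iff cons_in m by simp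
  qed
  obtain g where g: "continuous_map (hat_space S ?P) (X_inf S) g"
    "g ` topspace (hat_space S ?P) = ?h ` topspace ?Q"
    "\<And>z. z \<in> topspace ?Q \<Longrightarrow> g (?f z) = ?h z"
  proof (rule quotient_map_lift_exists[OF qf ch])
    show "?h z = ?h z'" if "z \<in> topspace ?Q" "z' \<in> topspace ?Q" "?f z = ?f z'" for z z'
      using fh[OF that(1,2)] that(3) by (rule iffD1)
  qed (rule that)
  have fs: "topspace (hat_space S ?P) = ?f ` topspace ?Q"
    using qf by (simp add: quotient_map_def)
  have "?h ` topspace ?Q = piN S ` TN"
  proof -
    have "piN S u \<in> ?h ` topspace ?Q" if "u \<in> TN" for u
      using that tail_in[OF that] by (intro image_eqI[of _ _ "(u 0, u \<circ> Suc)"]) (auto simp: TN_iff)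
    then show ?thesis using cons_in by auto
  qed
  moreover have "inj_on g (topspace (hat_space S ?P))"
    unfolding fs
  proof (rule inj_onI, elim imageE)
    fix c c' z z' assume z: "z \<in> topspace ?Q" "z' \<in> topspace ?Q" "c = ?f z" "c' = ?f z'" "g c = g c'"
    then have "?h z = ?h z'" using g(3)[OF z(1)] g(3)[OF z(2)] by simp
    then show "c = c'" using fh[OF z(1,2)] z(3,4) by simp
  qed
  moreover have "compact_space (hat_space S ?P)"
    using compact_space_quotient_map_image[OF qf] compact_YY compact_YN
    by (simp add: compact_space_prod_topology)
  ultimately have "homeomorphic_map (hat_space S ?P) (X_inf S) g"
    using continuous_imp_homeomorphic_map[OF g(1) _ Hausdorff_X_inf] g(2) by (simp add: topspace_X_inf)
  moreover have "phi_inf0 S a = g (hat_emb1 S ?P (phi S a))" if a: "a \<in> T0" for a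
  proof -
    obtain y b where b: "y \<in> TY" "b \<in> T0" "phi S a = proj S (y, b)" using phi_proj_ex a by blast
    obtain u where u: "u \<in> Gam S 0 (Pt0 b)" using Gam_0_ex b by blast
    then have uN: "u \<in> TN" by (simp add: Gam_iff)
    have "hat_emb1 S ?P (phi S a) = hat_proj S ?P (y, phi_inf0 S b)"
      using hat_emb1_proj[of ?P y b] b inj_phi_inf0 continuous_map_image_subset_topspace[OF cont_phi_inf0]
      by simp
    also have "\<dots> = ?f (y, u)" using phi_inf0_eq[OF b(2) u] by simp
    finally have "g (hat_emb1 S ?P (phi S a)) = piN S (cons y u)"
      using g(3)[of "(y, u)"] b uN by simp
    \<comment> \<open>Prepending \<open>y\<close> to an address of \<open>b\<close> gives an address
      of \<open>a\<close>, because \<open>\<phi>(a) = \<pi>(y, b)\<close> in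
      \<open>X\<^sub>1\<close>.\<close>
    moreover have "cons y u \<in> Gam S 0 (Pt0 a)"
    proof -
      have "cons y u \<in> Gam S (Suc 0) (pi1 S 0 (y, Pt0 b))"
        using Gam_pi1_I[of "cons y u" "Pt0 b" 0] cons_in b uN u T_0 by simp
      also have "pi1 S 0 (y, Pt0 b) = phi_step S 0 (Pt0 a)" using b by simp
      finally show ?thesis using Gam_phi_step[of "Pt0 a" 0] a T_0 by blast
    qed
    ultimately show ?thesis using phi_inf0_eq[OF a] by simp
  qed
  ultimately show ?thesis by (auto simp: pair_iso_def Phi_def)
qed

end

theorem theorem5p1:
  fixes S :: "('a, 'b, 'y) scheme"
  assumes "similarity_scheme S" and "fully_injective S"
  shows "R_inf S = R_hat S \<and> Phi_fixed_point S (X_inf S, phi_inf0 S)"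
proof -
  interpret inj_scheme S by unfold_locales (fact assms)+
  show ?thesis
    using R_inf_eq R_rel_eq_R_hat scheme_pair_X_inf pair_iso_X_inf by (simp add: Phi_fixed_point_def)
qed

end
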